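(* Let $X$ be a compact connected metric space, let $T:X\to X$ be a strictly ergodic homeomorphism, let $v\in C^{0}(X,\mathbb{R})$ and let $g>0$. Assume further that the Lyapunov exponent $E\mapsto L(E)$ is continuous. If $g>\overline{g}^{cr}:=\sup\{L(E):E\in\Sigma(0)\}$, then $\mathcal{E}_0=\{E\in\mathbb{C}:L(E)=g\}$ consists of a finite number of contours.
   Context: $(X,T)$ is strictly ergodic if it is both minimal and uniquely ergodic; $\mu$ denotes the unique $T$-invariant Borel probability measure. $\Sigma(0)$ is the spectrum, which is independent of $x\in X$ by minimality, of the Schrödinger operator on $\ell^2(\mathbb{Z})$ given by $[H(x)u]_n=-u_{n+1}-u_{n-1}+v(T^nx)u_n$. For $E\in\mathbb{C}$ let $$S_E(x)=\begin{pmatrix} v(x)-E&-1\\1&0\end{pmatrix},\qquad A_n(x)=S_E(T^{n-1}x)\cdots S_E(Tx)S_E(x)\quad (n\ge 1),$$ and define the Lyapunov exponent by $L(E)=\lim_{n\to\infty}\int_X\frac1n\log\|A_n(x)\|\,\mathrm{d}\mu(x)$, for $E\in\mathbb{C}$. Continuity of $L$ means continuity as a function on $\mathbb{C}$. Contours: let $\mathcal{E}_-=\{E\in\mathbb{C}:L(E)<g\}$. By upper semicontinuity of $L$, the set $\mathbb{R}\cap\mathcal{E}_-$ is a disjoint union of open intervals $\bigcup_j(a_j,b_j)$ (which are bounded). It is known that $L(E+\mathrm{i}\eta)=L(E-\mathrm{i}\eta)$ for $E,\eta\in\mathbb{R}$, and that $\mathcal{E}_0\cap\{\mathrm{Im}E>0\}$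 consists of disjoint analytic arcs $\mathrm{Im}E=f_j(\mathrm{Re}E)$, $a_j<\mathrm{Re}E<b_j$, with $f_j(a_j+0)=f_j(b_j-0)=0$. The contours constituting $\mathcal{E}_0$ are the sets $\{E\in\mathcal{E}_0:a_j\leqslant\mathrm{Re}E\leqslant b_j\}$, one for each interval $(a_j,b_j)$. The assertion is that $\mathcal{E}_0$ is the union of these contours and that there are only finitely many of them. *)

theory Defs
  imports "HOL-Probability.Probability"
begin

definition minimal_homeo :: "('a::topological_space \<Rightarrow> 'a) \<Rightarrow> bool" where
  "minimal_homeo T \<longleftrightarrow> (\<forall>K. closed K \<and> K \<noteq> {} \<and> T ` K = K \<longrightarrow> K = UNIV)"

definition invariant_prob :: "('a::topological_space \<Rightarrow> 'a) \<Rightarrow> 'a measure \<Rightarrow> bool" where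
  "invariant_prob T \<mu> \<longleftrightarrow> sets \<mu> = sets borel \<and> prob_space \<mu> \<and> distr \<mu> borel T = \<mu>"

definition uniquely_ergodic :: "('a::topological_space \<Rightarrow> 'a) \<Rightarrow> bool" where
  "uniquely_ergodic T \<longleftrightarrow> (\<exists>!\<mu>. invariant_prob T \<mu>)"

definition strictly_ergodic :: "('a::topological_space \<Rightarrow> 'a) \<Rightarrow> bool" where
  "strictly_ergodic T \<longleftrightarrow> minimal_homeo T \<and> uniquely_ergodic T"

definition int_iterate :: "('a \<Rightarrow> 'a) \<Rightarrow> int \<Rightarrow> 'a \<Rightarrow> 'a" where
  "int_iterate T n = (if 0 \<le> n then T ^^ nat n else inv T ^^ nat (- n))"

definition l2 :: "(int \<Rightarrow> complex) set" where
  "l2 = {u. (\<lambda>n. (cmod (u n))\<^sup>2) summable_on UNIV}"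

definition l2_norm :: "(int \<Rightarrow> complex) \<Rightarrow> real" where
  "l2_norm u = sqrt (\<Sum>\<^sub>\<infinity>n. (cmod (u n))\<^sup>2)"

definition l2_bounded_operator :: "((int \<Rightarrow> complex) \<Rightarrow> (int \<Rightarrow> complex)) \<Rightarrow> bool" where
  "l2_bounded_operator R \<longleftrightarrow>
     (\<forall>u\<in>l2. R u \<in> l2) \<and>
     (\<forall>u\<in>l2. \<forall>w\<in>l2. R (\<lambda>n. u n + w n) = (\<lambda>n. R u n + R w n)) \<and>
     (\<forall>c. \<forall>u\<in>l2. R (\<lambda>n. c * u n) = (\<lambda>n. c * R u n)) \<and>
     (\<exists>C. \<forall>u\<in>l2. l2_norm (R u) \<le> C * l2_norm u)"

definition l2_spectrum :: "((int \<Rightarrow> complex) \<Rightarrow> (int \<Rightarrow> complex)) \<Rightarrow> complex set" where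
  "l2_spectrum H = {E. \<not> (\<exists>R. l2_bounded_operator R \<and>
     (\<forall>u\<in>l2. R (\<lambda>n. H u n - E * u n) = u \<and> (\<lambda>n. H (R u) n - E * R u n) = u))}"

definition schroedinger ::
  "('a \<Rightarrow> 'a) \<Rightarrow> ('a \<Rightarrow> real) \<Rightarrow> 'a \<Rightarrow> (int \<Rightarrow> complex) \<Rightarrow> (int \<Rightarrow> complex)" where
  "schroedinger T v x u =
     (\<lambda>n. - u (n + 1) - u (n - 1) + complex_of_real (v (int_iterate T n x)) * u n)"

definition cocycle_matrix :: "('a \<Rightarrow> real) \<Rightarrow> complex \<Rightarrow> 'a \<Rightarrow> complex^2^2" where
  "cocycle_matrix v E x =
     vector [vector [complex_of_real (v x) - E, -1],
             vector [1, 0]]"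

primrec transfer_matrix ::
  "('a \<Rightarrow> 'a) \<Rightarrow> ('a \<Rightarrow> real) \<Rightarrow> complex \<Rightarrow> nat \<Rightarrow> 'a \<Rightarrow> complex^2^2" where
  "transfer_matrix T v E 0 x = mat 1"
| "transfer_matrix T v E (Suc n) x =
     cocycle_matrix v E ((T ^^ n) x) ** transfer_matrix T v E n x"

text \<open>The matrix norm is the Euclidean operator norm; \<open>norm\<close> on matrices would be
  the Frobenius norm.\<close>

definition lyapunov ::
  "('a \<Rightarrow> 'a) \<Rightarrow> ('a \<Rightarrow> real) \<Rightarrow> 'a measure \<Rightarrow> complex \<Rightarrow> real" where
  "lyapunov T v \<mu> E =
     lim (\<lambda>n. \<integral>x. (1 / real n) * ln (onorm ((*v) (transfer_matrix T v E n x))) \<partial>\<mu>)"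

definition contour_intervals :: "(complex \<Rightarrow> real) \<Rightarrow> real \<Rightarrow> real set set" where
  "contour_intervals L g = components {t. L (complex_of_real t) < g}"

text \<open>For the Lyapunov exponent each \<open>J\<close> in \<open>contour_intervals L g\<close> is a bounded open
  interval, and \<open>Inf J\<close>, \<open>Sup J\<close> are its endpoints.\<close>

definition contour :: "(complex \<Rightarrow> real) \<Rightarrow> real \<Rightarrow> real set \<Rightarrow> complex set" where
  "contour L g J = {E. L E = g \<and> Inf J \<le> Re E \<and> Re E \<le> Sup J}"

end

theory Submission
  imports Defs "HOL-Computational_Algebra.Fundamental_Theorem_Algebra"
begin

text \<open>Write \<open>\<Sigma>\<close> for the spectrum, \<open>\<sigma> < g\<close> for the supremum of \<open>L\<close> on \<open>\<Sigma>\<close>, and \<open>S\<close> for the set of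
real \<open>t\<close> with \<open>L t < g\<close>, whose components are the contour intervals.  Three properties of \<open>L\<close>
suffice.

\<^item> Off the spectrum \<open>L\<close> is strictly midpoint concave on the real line: if \<open>t\<close> is real and not in
  \<open>\<Sigma>\<close>, then \<open>L (t + s) + L (t - s) < 2 * L t\<close> for all small \<open>s > 0\<close>
  (\<open>lyapunov_midpoint\<close>).  In particular \<open>L\<close> has no local minimum at such a point.
\<^item> \<open>L (Re z) \<le> L z\<close> (\<open>lyapunov_Re_le\<close>).
\<^item> \<open>L\<close> tends to infinity (\<open>lyapunov_growth\<close>).

By the third property \<open>S\<close> is bounded, and on the closure of each component the minimum of \<open>L\<close> is
attained inside the component; by the first property it is attained at a point where \<open>L \<le> \<sigma>\<close>.
So every component of \<open>S\<close> meets the set \<open>L \<le> \<sigma>\<close>, which is a compact subset of \<open>S\<close>.  As the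
components are open and disjoint, there are only finitely many.  If \<open>L z = g\<close>, then
\<open>L (Re z) \<le> g\<close> by the second property; a real point with \<open>L = g\<close> is off the spectrum, so by the
first property it is a limit of points of \<open>S\<close>.  Hence \<open>Re z\<close> lies in the closure of \<open>S\<close>, which
is the finite union of the closures of its components.

The properties of \<open>L\<close> come from the determinants \<open>\<phi> z n\<close> of the Dirichlet truncations of the
operator to \<open>n\<close> sites.  Up to signs and shifts of the base point they are the entries of the transfer matrices, and they factor as a product of
\<open>\<lambda> - z\<close> over \<open>n\<close> real eigenvalues \<open>\<lambda>\<close>.  Monotonicity in \<open>\<bar>Im z\<bar>\<close> is immediate from
the factorization.  Concavity follows from the concavity of \<open>t \<mapsto> ln \<bar>t + \<i> \<eta> - \<lambda>\<bar>\<close> on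
\<open>\<bar>t - \<lambda>\<bar> > \<eta>\<close>, once only boundedly many eigenvalues lie close to \<open>t\<close>.  This is where \<open>t \<notin> \<Sigma>\<close> is used: it gives
a bound \<open>c\<close> with \<open>\<parallel>(H(x) - t) u\<parallel> \<ge> c \<parallel>u\<parallel>\<close> for all finitely supported \<open>u\<close> and, since orbits are
dense, for all \<open>x\<close> at once (\<open>bounded_below_off_spectrum\<close>).  Three eigenvectors with eigenvalues
within \<open>c\<close> of \<open>t\<close> would have a combination that vanishes at both ends of the box and
violates this bound, so at most two eigenvalues are that close (\<open>few_roots_near\<close>).  At height \<open>\<eta> > 0\<close> these two
exceptional factors change the logarithm by a constant independent of \<open>n\<close>, and all entries of the transfer
matrix are comparable to \<open>\<phi> z n\<close>.  Dividing by \<open>n\<close>, letting \<open>n\<close> tend to infinity and then \<open>\<eta>\<close>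
to zero, by continuity of \<open>L\<close>, gives the first property.\<close>

section \<open>Dirichlet solutions and their zeros\<close>

text \<open>The solution of \<open>- u (k + 1) - u (k - 1) + V k * u k = z * u k\<close> on the half line with
\<open>u (-1) = 0\<close> and \<open>u 0 = 1\<close>; also the determinant of \<open>H - z\<close> truncated to the sites
\<open>0, \<dots>, n - 1\<close>.  The ring is arbitrary so that the same recursion, run over polynomials, also
yields the characteristic polynomial.\<close>

fun dirichlet_sol :: "(nat \<Rightarrow> 'a::comm_ring_1) \<Rightarrow> 'a \<Rightarrow> nat \<Rightarrow> 'a" where
  "dirichlet_sol V z 0 = 1"
| "dirichlet_sol V z (Suc 0) = V 0 - z"
| "dirichlet_sol V z (Suc (Suc n)) = (V (Suc n) - z) * dirichlet_sol V z (Suc n) - dirichlet_sol V z n"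

definition dirichlet_poly :: "(nat \<Rightarrow> 'a::comm_ring_1) \<Rightarrow> nat \<Rightarrow> 'a poly" where
  "dirichlet_poly V = dirichlet_sol (\<lambda>k. [:V k:]) [:0, 1:]"

lemma poly_dirichlet_poly: "poly (dirichlet_poly V n) z = dirichlet_sol V z n"
  unfolding dirichlet_poly_def by (induction V z n rule: dirichlet_sol.induct) (auto simp: algebra_simps)

lemma dirichlet_sol_of_real:
  "dirichlet_sol (\<lambda>k. complex_of_real (V k)) (of_real t) n = of_real (dirichlet_sol V t n)"
  by (induction V t n rule: dirichlet_sol.induct) auto

lemma dirichlet_sol_cnj:
  "dirichlet_sol (\<lambda>k. complex_of_real (V k)) (cnj z) n = cnj (dirichlet_sol (\<lambda>k. of_real (V k)) z n)"
  by (induction "\<lambda>k. complex_of_real (V k)" z n rule: dirichlet_sol.induct) auto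

text \<open>Expansion of the determinant along its first row instead of its last; it relates the
solution for the potential \<open>V\<close> to the solutions for the shifted potentials.\<close>

lemma dirichlet_sol_left:
  "dirichlet_sol V z (Suc (Suc n)) = (V 0 - z) * dirichlet_sol (\<lambda>k. V (Suc k)) z (Suc n) - dirichlet_sol (\<lambda>k. V (Suc (Suc k))) z n"
proof (induction n rule: induct_nat_012)
  case 0 then show ?case by (simp add: algebra_simps)
next
  case 1 then show ?case by (simp add: algebra_simps)
next
  case (ge2 n)
  have "dirichlet_sol V z (Suc (Suc (Suc (Suc n)))) = (V (Suc (Suc (Suc n))) - z) * dirichlet_sol V z (Suc (Suc (Suc n))) - dirichlet_sol V z (Suc (Suc n))"
    by simp
  also have "\<dots> = (V 0 - z) * dirichlet_sol (\<lambda>k. V (Suc k)) z (Suc (Suc (Suc n)))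
      - dirichlet_sol (\<lambda>k. V (Suc (Suc k))) z (Suc (Suc n))"
    unfolding ge2.IH by (simp add: algebra_simps)
  finally show ?case .
qed

text \<open>At two zeros of the solution at site \<open>n + 1\<close> the right-hand side vanishes, so the
corresponding eigenvectors are orthogonal.\<close>

lemma christoffel_darboux:
  "(a - b) * (\<Sum>k<Suc n. dirichlet_sol V a k * dirichlet_sol V b k) =
     dirichlet_sol V a n * dirichlet_sol V b (Suc n) - dirichlet_sol V a (Suc n) * dirichlet_sol V b n"
proof (induction n)
  case (Suc n)
  have "(a - b) * (\<Sum>k<Suc (Suc n). dirichlet_sol V a k * dirichlet_sol V b k) =
     (a - b) * (\<Sum>k<Suc n. dirichlet_sol V a k * dirichlet_sol V b k) + (a - b) * (dirichlet_sol V a (Suc n) * dirichlet_sol V b (Suc n))"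
    by (simp add: algebra_simps)
  then show ?case unfolding Suc.IH by (simp add: algebra_simps)
qed simp

text \<open>The limit of the previous identity for coinciding arguments.  A double zero of the
polynomial at site \<open>n + 1\<close> would make a sum of squares vanish whose first term is one, so real zeros are simple.\<close>

lemma christoffel_darboux_diagonal:
  fixes V :: "nat \<Rightarrow> 'a::idom"
  shows "(\<Sum>k<Suc n. (dirichlet_poly V k)\<^sup>2) =
     dirichlet_poly V (Suc n) * pderiv (dirichlet_poly V n) - pderiv (dirichlet_poly V (Suc n)) * dirichlet_poly V n"
proof (induction n)
  case 0 then show ?case by (simp add: dirichlet_poly_def pderiv_pCons pderiv_diff)
next
  case (Suc n)
  define X where "X = [:V (Suc n):] - [:0,1:]"
  have X: "pderiv X = -1" by (simp add: X_def pderiv_pCons pderiv_diff one_pCons)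
  have r: "dirichlet_poly V (Suc (Suc n)) = X * dirichlet_poly V (Suc n) - dirichlet_poly V n"
    by (simp add: dirichlet_poly_def X_def)
  have d: "pderiv (dirichlet_poly V (Suc (Suc n))) =
     X * pderiv (dirichlet_poly V (Suc n)) - dirichlet_poly V (Suc n) - pderiv (dirichlet_poly V n)"
    unfolding r by (simp add: pderiv_diff pderiv_mult X)
  have "(\<Sum>k<Suc (Suc n). (dirichlet_poly V k)\<^sup>2) = (\<Sum>k<Suc n. (dirichlet_poly V k)\<^sup>2) + (dirichlet_poly V (Suc n))\<^sup>2"
    by simp
  then show ?case unfolding Suc.IH unfolding d unfolding r by (simp add: algebra_simps power2_eq_square)
qed

text \<open>The lower half plane below \<open>- Im z\<close> is invariant under one step of the Riccati recursion
satisfied by ratios of consecutive solution values.  This single fact gives real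
eigenvalues and, for non-real \<open>z\<close>, the comparability of the transfer matrix entries.\<close>

lemma Im_continued_fraction_step:
  assumes "Im w \<le> - Im z" "Im z > 0"
  shows "Im ((of_real a - z) - 1 / w) \<le> - Im z"
proof -
  have "Im (1 / w) = - Im w / (cmod w)\<^sup>2"
    by (simp add: Im_divide cmod_power2)
  then show ?thesis using assms by (simp add: divide_nonpos_nonneg)
qed

lemma dirichlet_sol_ratio_right:
  assumes "Im z > 0"
  defines "W \<equiv> \<lambda>V k. complex_of_real (V k)"
  shows "dirichlet_sol (W V) z n \<noteq> 0 \<and> Im (dirichlet_sol (W V) z (Suc n) / dirichlet_sol (W V) z n) \<le> - Im z"
proof (induction n)
  case (Suc n)
  then have nz: "dirichlet_sol (W V) z (Suc n) \<noteq> 0" using assms(1) by auto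
  have "dirichlet_sol (W V) z (Suc (Suc n)) / dirichlet_sol (W V) z (Suc n)
     = (of_real (V (Suc n)) - z) - 1 / (dirichlet_sol (W V) z (Suc n) / dirichlet_sol (W V) z n)"
    using nz by (simp add: W_def field_simps)
  then show ?case using nz Im_continued_fraction_step[OF conjunct2[OF Suc.IH] assms(1), of "V (Suc n)"] by metis
qed (simp add: W_def)

lemma dirichlet_sol_ratio_left:
  assumes "Im z > 0"
  defines "W \<equiv> \<lambda>V k. complex_of_real (V k)"
  shows "Im (dirichlet_sol (W V) z (Suc n) / dirichlet_sol (W (\<lambda>k. V (Suc k))) z n) \<le> - Im z"
proof (induction n arbitrary: V)
  case (Suc n)
  have nz: "dirichlet_sol (W V) z n \<noteq> 0" for V n
    using dirichlet_sol_ratio_right[OF assms(1)] by (simp add: W_def)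
  have "dirichlet_sol (W V) z (Suc (Suc n)) / dirichlet_sol (W (\<lambda>k. V (Suc k))) z (Suc n)
     = (of_real (V 0) - z) - 1 / (dirichlet_sol (W (\<lambda>k. V (Suc k))) z (Suc n) / dirichlet_sol (W (\<lambda>k. V (Suc (Suc k)))) z n)"
    using nz[of "\<lambda>k. V (Suc k)" "Suc n"] unfolding dirichlet_sol_left by (simp add: W_def field_simps del: dirichlet_sol.simps)
  then show ?case using Im_continued_fraction_step[OF Suc.IH assms(1), of "V 0" "\<lambda>k. V (Suc k)"] by simp
qed (simp add: W_def)

lemma norm_ge_of_Im_ratio:
  assumes "Im (a / b) \<le> - e" "e > 0"
  shows "e * cmod b \<le> cmod a"
proof -
  have "e \<le> cmod (a / b)" using assms abs_Im_le_cmod[of "a/b"] by linarith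
  then show ?thesis by (cases "b = 0") (auto simp: norm_divide field_simps)
qed

lemma dirichlet_sol_norm_right: "Im z > 0 \<Longrightarrow> Im z * cmod (dirichlet_sol (\<lambda>k. complex_of_real (V k)) z n) \<le> cmod (dirichlet_sol (\<lambda>k. of_real (V k)) z (Suc n))"
  using dirichlet_sol_ratio_right norm_ge_of_Im_ratio by metis

lemma dirichlet_sol_norm_left: "Im z > 0 \<Longrightarrow> Im z * cmod (dirichlet_sol (\<lambda>k. complex_of_real (V (Suc k))) z n) \<le> cmod (dirichlet_sol (\<lambda>k. of_real (V k)) z (Suc n))"
  using dirichlet_sol_ratio_left norm_ge_of_Im_ratio by metis

lemma dirichlet_sol_roots_real:
  assumes "dirichlet_sol (\<lambda>k. complex_of_real (V k)) z n = 0"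
  shows "z \<in> \<real>"
proof -
  have "\<not> Im z > 0" "\<not> Im (cnj z) > 0"
    using assms dirichlet_sol_ratio_right[of z V n] dirichlet_sol_ratio_right[of "cnj z" V n] dirichlet_sol_cnj[of V z n] by auto
  then show ?thesis by (simp add: complex_is_Real_iff)
qed

lemma dirichlet_poly_degree: 
  fixes V :: "nat \<Rightarrow> 'a::idom"
  shows "degree (dirichlet_poly V n) = n \<and> lead_coeff (dirichlet_poly V n) = (-1) ^ n"
proof (induction n rule: induct_nat_012)
  case (ge2 n)
  have r: "dirichlet_poly V (Suc (Suc n)) = ([:V (Suc n), -1:]) * dirichlet_poly V (Suc n) - dirichlet_poly V n"
    by (simp add: dirichlet_poly_def)
  have nz: "dirichlet_poly V (Suc n) \<noteq> 0" using ge2 by force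
  have m: "degree ([:V (Suc n), -1:] * dirichlet_poly V (Suc n)) = Suc (Suc n)"
    using nz ge2 by (subst degree_mult_eq) auto
  have m2: "lead_coeff ([:V (Suc n), -1:] * dirichlet_poly V (Suc n)) = (-1) ^ (Suc (Suc n))"
  proof -
    have "lead_coeff [:V (Suc n), -1:] = -1" by simp
    moreover have "lead_coeff (dirichlet_poly V (Suc n)) = (-1) ^ Suc n" using ge2(2) by blast
    ultimately show ?thesis unfolding lead_coeff_mult by simp
  qed
  have d: "degree (dirichlet_poly V (Suc (Suc n))) = Suc (Suc n)"
  proof -
    have "degree ([:V (Suc n), -1:] * dirichlet_poly V (Suc n) + - dirichlet_poly V n) = Suc (Suc n)"
      unfolding m[symmetric] by (rule degree_add_eq_left) (use m ge2(1) in simp)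
    then show ?thesis unfolding r by (simp only: diff_conv_add_uminus)
  qed
  have "coeff (dirichlet_poly V n) (Suc (Suc n)) = 0" using ge2 by (simp add: coeff_eq_0)
  then have "lead_coeff (dirichlet_poly V (Suc (Suc n))) = (-1) ^ (Suc (Suc n))"
    unfolding d using m m2 unfolding r coeff_diff by (simp only: m diff_zero)
  then show ?case using d by blast
qed (auto simp: dirichlet_poly_def)

definition dirichlet_spectrum :: "(nat \<Rightarrow> real) \<Rightarrow> nat \<Rightarrow> real set" where
  "dirichlet_spectrum V n = {t. dirichlet_sol V t n = 0}"

text \<open>The characteristic polynomial has only real zeros because ratios of consecutive values
stay off the real axis for non-real \<open>z\<close>, and they are simple by the diagonal Christoffel--Darboux
identity, so the factorization over the complex numbers runs over a set of \<open>n\<close> real numbers.\<close>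

lemma dirichlet_sol_factor:
  "finite (dirichlet_spectrum V n) \<and> card (dirichlet_spectrum V n) = n \<and>
   (\<forall>z. cmod (dirichlet_sol (\<lambda>k. of_real (V k)) z n) = (\<Prod>t\<in>dirichlet_spectrum V n. cmod (z - of_real t)))"
proof -
  let ?W = "\<lambda>k. complex_of_real (V k)"
  let ?p = "dirichlet_poly ?W n"
  have p0: "?p \<noteq> 0" using dirichlet_poly_degree[of ?W n] by force
  have roots: "{z. poly ?p z = 0} = of_real ` dirichlet_spectrum V n"
  proof -
    have "z \<in> of_real ` dirichlet_spectrum V n" if "poly ?p z = 0" for z
    proof -
      have "z \<in> \<real>" using that dirichlet_sol_roots_real[of V z n] by (simp add: poly_dirichlet_poly)
      then obtain t where "z = of_real t" by (auto elim: Reals_cases)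
      then show ?thesis using that by (auto simp: poly_dirichlet_poly dirichlet_sol_of_real dirichlet_spectrum_def)
    qed
    then show ?thesis by (auto simp: poly_dirichlet_poly dirichlet_sol_of_real dirichlet_spectrum_def)
  qed
  have sq: "rsquarefree ?p"
  proof (cases n)
    case 0
    then show ?thesis by (simp add: rsquarefree_roots dirichlet_poly_def)
  next
    case (Suc m)
    have False if a: "poly ?p z = 0" "poly (pderiv ?p) z = 0" for z
    proof -
      obtain t where t: "z = of_real t" using a(1) roots by auto
      have "poly (\<Sum>k<Suc m. (dirichlet_poly ?W k)\<^sup>2) z = 0"
        unfolding christoffel_darboux_diagonal using a Suc by simp
      then have "(\<Sum>k<Suc m. (complex_of_real (dirichlet_sol V t k))\<^sup>2) = 0"
        by (simp add: poly_sum poly_dirichlet_poly t dirichlet_sol_of_real)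
      then have "of_real (\<Sum>k<Suc m. (dirichlet_sol V t k)\<^sup>2) = complex_of_real 0"
        by simp
      then have "(\<Sum>k<Suc m. (dirichlet_sol V t k)\<^sup>2) = 0"
        using of_real_eq_iff by blast
      moreover have "(dirichlet_sol V t 0)\<^sup>2 \<le> (\<Sum>k<Suc m. (dirichlet_sol V t k)\<^sup>2)"
        by (rule member_le_sum) auto
      ultimately show False by simp
    qed
    then show ?thesis by (auto simp: rsquarefree_roots)
  qed
  have fin: "finite (dirichlet_spectrum V n)"
    using poly_roots_finite[OF p0] roots finite_imageD[of complex_of_real "dirichlet_spectrum V n"] by (simp add: inj_on_def)
  have dec: "?p = smult ((-1)^n) (\<Prod>z\<in>of_real ` dirichlet_spectrum V n. [:-z, 1:])"
    using complex_poly_decompose_rsquarefree[OF sq] unfolding conjunct2[OF dirichlet_poly_degree[of ?W n]] roots by (rule sym)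
  have dec': "?p = smult ((-1)^n) (\<Prod>t\<in>dirichlet_spectrum V n. [:- complex_of_real t, 1:])"
    unfolding dec by (subst prod.reindex) (auto simp: inj_on_def)
  have "degree ?p = card (dirichlet_spectrum V n)"
    unfolding dec' by (simp add: degree_prod_eq_sum_degree)
  then have "card (dirichlet_spectrum V n) = n" using dirichlet_poly_degree[of ?W n] by simp
  moreover have "cmod (dirichlet_sol ?W z n) = (\<Prod>t\<in>dirichlet_spectrum V n. cmod (z - of_real t))" for z
    unfolding poly_dirichlet_poly[symmetric] dec' by (simp add: poly_prod norm_mult norm_power prod_norm[symmetric])
  ultimately show ?thesis using fin by blast
qed

text \<open>Beyond the range of the potential the first term of the recursion dominates, and the
solution grows at least geometrically.\<close>

lemma dirichlet_sol_large:
  fixes z :: "'a::{real_normed_field}"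
  assumes V: "\<And>k. norm (V k) \<le> B" and K: "1 \<le> K" "norm z \<ge> B + 1 + K"
  shows "K * norm (dirichlet_sol V z n) \<le> norm (dirichlet_sol V z (Suc n)) \<and> dirichlet_sol V z n \<noteq> 0"
proof (induction n)
  case 0 show ?case using V[of 0] K norm_triangle_ineq2[of z "V 0"] by (simp add: norm_minus_commute)
next
  case (Suc n)
  have a: "norm (V (Suc n) - z) \<ge> 1 + K"
    using V[of "Suc n"] K norm_triangle_ineq2[of z "V (Suc n)"] by (simp add: norm_minus_commute)
  have "1 * norm (dirichlet_sol V z n) \<le> K * norm (dirichlet_sol V z n)"
    using K(1) by (rule mult_right_mono) simp
  then have b: "norm (dirichlet_sol V z n) \<le> norm (dirichlet_sol V z (Suc n))"
    using Suc by linarith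
  have "(1 + K) * norm (dirichlet_sol V z (Suc n)) \<le> norm (V (Suc n) - z) * norm (dirichlet_sol V z (Suc n))"
    using a by (rule mult_right_mono) auto
  also have "\<dots> \<le> norm (dirichlet_sol V z (Suc (Suc n))) + norm (dirichlet_sol V z n)"
    using norm_triangle_ineq2[of "(V (Suc n) - z) * dirichlet_sol V z (Suc n)" "dirichlet_sol V z n"] by (simp add: norm_mult)
  finally have "K * norm (dirichlet_sol V z (Suc n)) \<le> norm (dirichlet_sol V z (Suc (Suc n)))"
    using b by (simp add: algebra_simps)
  moreover have "dirichlet_sol V z (Suc n) \<noteq> 0" using Suc K b by auto
  ultimately show ?case by blast
qed

section \<open>Few Dirichlet eigenvalues near a point off the spectrum\<close>

text \<open>The bound \<open>\<parallel>(H - E) u\<parallel> \<ge> c \<parallel>u\<parallel>\<close> tested only on real \<open>u\<close> supported in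
\<open>{1..<n}\<close>.  Both sides are then finite sums over \<open>{..n}\<close>, which makes the condition closed in \<open>V\<close>.
Since \<open>u 0 = 0\<close>, the truncated difference \<open>k - 1\<close> at \<open>k = 0\<close> correctly contributes zero.\<close>

definition bounded_below_at :: "real \<Rightarrow> real \<Rightarrow> (nat \<Rightarrow> real) \<Rightarrow> bool" where
  "bounded_below_at c E V \<longleftrightarrow>
     (\<forall>n u. u 0 = 0 \<and> (\<forall>k\<ge>n. u k = 0) \<longrightarrow>
        c\<^sup>2 * (\<Sum>k\<le>n. (u k)\<^sup>2) \<le> (\<Sum>k\<le>n. (V k * u k - u (Suc k) - u (k - 1) - E * u k)\<^sup>2))"

lemma sum_square_orthogonal3:
  fixes f g h :: "'b \<Rightarrow> real"
  assumes "(\<Sum>k\<in>A. f k * g k) = 0" "(\<Sum>k\<in>A. f k * h k) = 0" "(\<Sum>k\<in>A. g k * h k) = 0"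
  shows "(\<Sum>k\<in>A. (x * f k + y * g k + z * h k)\<^sup>2) =
    x\<^sup>2 * (\<Sum>k\<in>A. (f k)\<^sup>2) + y\<^sup>2 * (\<Sum>k\<in>A. (g k)\<^sup>2) + z\<^sup>2 * (\<Sum>k\<in>A. (h k)\<^sup>2)"
proof -
  have "(\<Sum>k\<in>A. (x * f k + y * g k + z * h k)\<^sup>2) =
    (\<Sum>k\<in>A. x\<^sup>2 * (f k)\<^sup>2 + y\<^sup>2 * (g k)\<^sup>2 + z\<^sup>2 * (h k)\<^sup>2
      + 2 * x * y * (f k * g k) + 2 * x * z * (f k * h k) + 2 * y * z * (g k * h k))"
    by (rule sum.cong) (auto simp: algebra_simps power2_eq_square)
  also have "\<dots> = x\<^sup>2 * (\<Sum>k\<in>A. (f k)\<^sup>2) + y\<^sup>2 * (\<Sum>k\<in>A. (g k)\<^sup>2) + z\<^sup>2 * (\<Sum>k\<in>A. (h k)\<^sup>2)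
     + 2 * x * y * (\<Sum>k\<in>A. f k * g k) + 2 * x * z * (\<Sum>k\<in>A. f k * h k) + 2 * y * z * (\<Sum>k\<in>A. g k * h k)"
    by (simp only: sum.distrib sum_distrib_left)
  finally show ?thesis using assms by simp
qed

lemma eigenvectors_orthogonal:
  assumes "a \<in> dirichlet_spectrum V (Suc m)" "b \<in> dirichlet_spectrum V (Suc m)" "a \<noteq> b"
  shows "(\<Sum>k\<le>m. dirichlet_sol V a k * dirichlet_sol V b k) = 0"
  using christoffel_darboux[of a b V m] assms by (simp add: dirichlet_spectrum_def lessThan_Suc_atMost)

text \<open>Three eigenvectors of the truncation, all equal to one at the first site, leave room for
a nontrivial combination \<open>w\<close> that vanishes at the first and the last site.  Extended by zero it
satisfies \<open>(H - E) w = \<Sum> (\<lambda> - E) w\<^sub>\<lambda>\<close> on the whole line, and by orthogonality the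
norm of this is less than \<open>c \<parallel>w\<parallel>\<close>.\<close>

lemma few_roots_near:
  assumes lb: "bounded_below_at c E V" and c: "c > 0"
  shows "card {t \<in> dirichlet_spectrum V n. \<bar>t - E\<bar> < c} \<le> 2"
proof (rule ccontr)
  assume "\<not> ?thesis"
  then have "3 \<le> card {t \<in> dirichlet_spectrum V n. \<bar>t - E\<bar> < c}" by simp
  then obtain S where S: "S \<subseteq> {t \<in> dirichlet_spectrum V n. \<bar>t - E\<bar> < c}" "card S = 3"
    by (meson obtain_subset_with_card_n)
  then obtain p q r where pqr: "S = {p, q, r}" "p \<noteq> q" "p \<noteq> r" "q \<noteq> r"
    by (auto simp: card_3_iff)
  have mem: "p \<in> dirichlet_spectrum V n" "q \<in> dirichlet_spectrum V n" "r \<in> dirichlet_spectrum V n"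
    and near: "\<bar>p - E\<bar> < c" "\<bar>q - E\<bar> < c" "\<bar>r - E\<bar> < c"
    using S pqr by auto
  obtain m where n: "n = Suc m" using mem by (cases n) (auto simp: dirichlet_spectrum_def)
  define f where "f = dirichlet_sol V"
  have f0: "f t 0 = 1" for t by (simp add: f_def)
  have fend: "f p (Suc m) = 0" "f q (Suc m) = 0" "f r (Suc m) = 0"
    using mem by (auto simp: f_def n dirichlet_spectrum_def)
  \<comment> \<open>A nonzero vector orthogonal to \<open>(1, 1, 1)\<close> and \<open>(f p m, f q m, f r m)\<close>: their cross product, or an obvious choice if that may vanish.\<close>
  have "\<exists>x y z::real. (x \<noteq> 0 \<or> y \<noteq> 0 \<or> z \<noteq> 0) \<and> x + y + z = 0 \<and> x * f p m + y * f q m + z * f r m = 0"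
  proof (cases "f p m = f q m")
    case True
    then show ?thesis by (intro exI[of _ 1] exI[of _ "-1"] exI[of _ 0]) auto
  next
    case False
    then show ?thesis
      by (intro exI[of _ "f q m - f r m"] exI[of _ "f r m - f p m"] exI[of _ "f p m - f q m"])
         (auto simp: algebra_simps)
  qed
  then obtain x y z where xyz: "x \<noteq> 0 \<or> y \<noteq> 0 \<or> z \<noteq> 0" "x + y + z = 0"
      "x * f p m + y * f q m + z * f r m = 0" by blast
  define w where "w k = x * f p k + y * f q k + z * f r k" for k
  define u where "u k = (if k < m then w k else 0)" for k
  have w0: "w 0 = 0" "w m = 0" "w (Suc m) = 0" using xyz by (auto simp: w_def f0 fend)
  \<comment> \<open>At the last site and one beyond, \<open>w\<close> vanishes by itself, so the cut-off leaves the recursion intact there.\<close>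
  have uw: "u k = w k" if "k \<le> Suc m" for k
    using that w0 by (cases "k < m"; cases "k = m"; cases "k = Suc m") (auto simp: u_def)
  have res: "V k * u k - u (Suc k) - u (k - 1) - E * u k
      = (x * (p - E)) * f p k + (y * (q - E)) * f q k + (z * (r - E)) * f r k" if "k \<le> m" for k
  proof -
    have "V k * w k - w (Suc k) - w (k - 1) - E * w k
      = (x * (p - E)) * f p k + (y * (q - E)) * f q k + (z * (r - E)) * f r k"
    proof (cases k)
      case 0
      have "w 1 = V 0 * (x + y + z) - (x * p + y * q + z * r)"
        by (simp add: w_def f_def algebra_simps)
      then have "w 1 = - (x * p + y * q + z * r)" using xyz(2) by simp
      moreover have "x * (p - E) + y * (q - E) + z * (r - E) = (x * p + y * q + z * r) - E * (x + y + z)"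
        by (simp add: algebra_simps)
      ultimately show ?thesis using 0 w0 xyz(2) by (simp add: f0)
    next
      case (Suc j)
      then show ?thesis by (simp add: w_def f_def algebra_simps)
    qed
    then show ?thesis using that by (simp add: uw)
  qed
  have orth: "(\<Sum>k\<le>m. f p k * f q k) = 0" "(\<Sum>k\<le>m. f p k * f r k) = 0" "(\<Sum>k\<le>m. f q k * f r k) = 0"
    unfolding f_def using mem pqr n by (auto intro!: eigenvectors_orthogonal)
  define N where "N t = (\<Sum>k\<le>m. (f t k)\<^sup>2)" for t
  have N: "N t > 0" for t
  proof -
    have "(f t 0)\<^sup>2 \<le> N t" unfolding N_def by (rule member_le_sum) auto
    then show ?thesis by (simp add: f0)
  qed
  have "c\<^sup>2 * (\<Sum>k\<le>m. (u k)\<^sup>2) \<le> (\<Sum>k\<le>m. (V k * u k - u (Suc k) - u (k - 1) - E * u k)\<^sup>2)"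
    by (rule lb[unfolded bounded_below_at_def, rule_format]) (use uw[of 0] w0 in \<open>auto simp: u_def\<close>)
  also have "\<dots> = (\<Sum>k\<le>m. ((x * (p - E)) * f p k + (y * (q - E)) * f q k + (z * (r - E)) * f r k)\<^sup>2)"
    by (rule sum.cong) (use res in auto)
  also have "\<dots> = (x * (p - E))\<^sup>2 * N p + (y * (q - E))\<^sup>2 * N q + (z * (r - E))\<^sup>2 * N r"
    unfolding N_def by (rule sum_square_orthogonal3[OF orth])
  finally have le: "c\<^sup>2 * (\<Sum>k\<le>m. (u k)\<^sup>2) \<le> \<dots>" .
  have "(\<Sum>k\<le>m. (u k)\<^sup>2) = (\<Sum>k\<le>m. (x * f p k + y * f q k + z * f r k)\<^sup>2)"
    by (rule sum.cong) (auto simp: uw w_def)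
  also have "\<dots> = x\<^sup>2 * N p + y\<^sup>2 * N q + z\<^sup>2 * N r"
    unfolding N_def by (rule sum_square_orthogonal3[OF orth])
  finally have "c\<^sup>2 * (x\<^sup>2 * N p + y\<^sup>2 * N q + z\<^sup>2 * N r)
      \<le> (x * (p - E))\<^sup>2 * N p + (y * (q - E))\<^sup>2 * N q + (z * (r - E))\<^sup>2 * N r" using le by simp
  moreover have sm: "(a * (t - E))\<^sup>2 * N t \<le> c\<^sup>2 * (a\<^sup>2 * N t)"
      "a \<noteq> 0 \<Longrightarrow> (a * (t - E))\<^sup>2 * N t < c\<^sup>2 * (a\<^sup>2 * N t)" if "\<bar>t - E\<bar> < c" for a t
  proof -
    have lt: "(t - E)\<^sup>2 < c\<^sup>2" using that c by (metis abs_of_pos power2_abs power_strict_mono abs_ge_zero pos2)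
    have e: "(a * (t - E))\<^sup>2 * N t = (t - E)\<^sup>2 * (a\<^sup>2 * N t)" by (simp add: power_mult_distrib)
    show "(a * (t - E))\<^sup>2 * N t \<le> c\<^sup>2 * (a\<^sup>2 * N t)"
      unfolding e using lt N[of t] by (intro mult_right_mono) auto
    show "(a * (t - E))\<^sup>2 * N t < c\<^sup>2 * (a\<^sup>2 * N t)" if "a \<noteq> 0"
      unfolding e using lt N[of t] that by (intro mult_strict_right_mono) auto
  qed
  ultimately show False
    using sm[OF near(1), of x] sm[OF near(2), of y] sm[OF near(3), of z] xyz(1)
    by (smt (verit) distrib_left)
qed

section \<open>A strict midpoint inequality for Dirichlet determinants\<close>

text \<open>The concavity of \<open>d \<mapsto> ln \<bar>d + \<i> \<eta>\<bar>\<close> for \<open>\<bar>d\<bar> > \<eta>\<close> in quantitative form: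
the two squared distances multiply to \<open>(d\<^sup>2 + \<eta>\<^sup>2)\<^sup>2 - s\<^sup>2 * (2 * d\<^sup>2 - s\<^sup>2 - 2 * \<eta>\<^sup>2)\<close>.\<close>

lemma far_factor:
  assumes "c \<le> \<bar>d\<bar>" "\<bar>d\<bar> \<le> D" "0 < s" "s \<le> c / 2" "0 < \<eta>" "\<eta> \<le> c / 2"
  shows "cmod (Complex (d + s) \<eta>) * cmod (Complex (d - s) \<eta>)
     \<le> sqrt (1 - s\<^sup>2 / (4 * D\<^sup>2)) * (cmod (Complex d \<eta>))\<^sup>2"
proof -
  have s2: "s\<^sup>2 \<le> d\<^sup>2 / 4" and e2: "\<eta>\<^sup>2 \<le> d\<^sup>2 / 4"
    using assms power_mono[of s "\<bar>d\<bar>/2" 2] power_mono[of \<eta> "\<bar>d\<bar>/2" 2] by (auto simp: power_divide)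
  have d0: "d\<^sup>2 > 0" using assms by auto
  have D: "d\<^sup>2 \<le> D\<^sup>2" using assms by (metis abs_ge_zero power2_abs power_mono)
  then have D0: "D\<^sup>2 > 0" using d0 by linarith
  have eq: "((d + s)\<^sup>2 + \<eta>\<^sup>2) * ((d - s)\<^sup>2 + \<eta>\<^sup>2)
     = (d\<^sup>2 + \<eta>\<^sup>2)\<^sup>2 - s\<^sup>2 * (2 * d\<^sup>2 - s\<^sup>2 - 2 * \<eta>\<^sup>2)"
    by (simp add: power2_eq_square algebra_simps)
  have "(d\<^sup>2 + \<eta>\<^sup>2)\<^sup>2 \<le> (2 * d\<^sup>2)\<^sup>2" using e2 d0 by (intro power_mono) (linarith, simp)
  then have q4: "(d\<^sup>2 + \<eta>\<^sup>2)\<^sup>2 \<le> 4 * (d\<^sup>2 * d\<^sup>2)" by (simp add: power2_eq_square)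
  have "s\<^sup>2 / (4 * D\<^sup>2) * (d\<^sup>2 + \<eta>\<^sup>2)\<^sup>2 \<le> s\<^sup>2 / (4 * d\<^sup>2) * (4 * (d\<^sup>2 * d\<^sup>2))"
    using q4 D d0 D0 by (intro mult_mono divide_left_mono) auto
  also have "\<dots> = s\<^sup>2 * d\<^sup>2" using d0 by (simp add: field_simps)
  also have "\<dots> \<le> s\<^sup>2 * (2 * d\<^sup>2 - s\<^sup>2 - 2 * \<eta>\<^sup>2)"
    using s2 e2 d0 by (intro mult_left_mono) (linarith, simp)
  finally have "((d + s)\<^sup>2 + \<eta>\<^sup>2) * ((d - s)\<^sup>2 + \<eta>\<^sup>2) \<le> (1 - s\<^sup>2 / (4 * D\<^sup>2)) * (d\<^sup>2 + \<eta>\<^sup>2)\<^sup>2"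
    unfolding eq by (simp add: algebra_simps)
  then have "sqrt (((d + s)\<^sup>2 + \<eta>\<^sup>2) * ((d - s)\<^sup>2 + \<eta>\<^sup>2)) \<le> sqrt ((1 - s\<^sup>2 / (4 * D\<^sup>2)) * (d\<^sup>2 + \<eta>\<^sup>2)\<^sup>2)"
    by simp
  then show ?thesis by (simp add: cmod_def real_sqrt_mult)
qed

text \<open>For a zero close to \<open>E\<close> concavity fails, but the height \<open>\<eta>\<close> keeps the loss bounded.\<close>

lemma near_factor:
  assumes "\<bar>d\<bar> < c" "0 < s" "s \<le> c / 2" "0 < \<eta>" "\<eta> \<le> c / 2"
  shows "cmod (Complex (d + s) \<eta>) * cmod (Complex (d - s) \<eta>) \<le> 4 * c\<^sup>2 / \<eta>\<^sup>2 * (cmod (Complex d \<eta>))\<^sup>2"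
proof -
  have "cmod (Complex (d + s) \<eta>) \<le> 2 * c" "cmod (Complex (d - s) \<eta>) \<le> 2 * c"
    using assms cmod_le[of "Complex (d + s) \<eta>"] cmod_le[of "Complex (d - s) \<eta>"] by auto
  then have "cmod (Complex (d + s) \<eta>) * cmod (Complex (d - s) \<eta>) \<le> (2 * c) * (2 * c)"
    using assms by (intro mult_mono) auto
  also have "\<dots> = 4 * c\<^sup>2 / \<eta>\<^sup>2 * \<eta>\<^sup>2" using assms by (simp add: power2_eq_square)
  also have "\<dots> \<le> 4 * c\<^sup>2 / \<eta>\<^sup>2 * (cmod (Complex d \<eta>))\<^sup>2"
    by (intro mult_left_mono) (auto simp: cmod_power2)
  finally show ?thesis .
qed

lemma dirichlet_spectrum_bounded:
  assumes "\<And>k. \<bar>V k\<bar> \<le> B" "t \<in> dirichlet_spectrum V n"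
  shows "\<bar>t\<bar> \<le> B + 2"
  using dirichlet_sol_large[of V B 1 t n] assms by (force simp: dirichlet_spectrum_def)

text \<open>All but at most two of the \<open>n\<close> factors gain \<open>\<rho> < 1\<close>; each of the two exceptional
ones costs at most \<open>4 * c\<^sup>2 / \<eta>\<^sup>2\<close>, and the factor \<open>1 / \<rho>\<^sup>2\<close> restores the exponent to \<open>n\<close>.\<close>

lemma dirichlet_sol_midpoint:
  fixes V :: "nat \<Rightarrow> real" and n :: nat
  assumes lb: "bounded_below_at c E V" and V: "\<And>k. \<bar>V k\<bar> \<le> B"
    and D: "D = \<bar>E\<bar> + B + 2 + c" and s: "0 < s" "s \<le> c / 2" and \<eta>: "0 < \<eta>" "\<eta> \<le> c / 2"
    and \<rho>: "\<rho> = sqrt (1 - s\<^sup>2 / (4 * D\<^sup>2))"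
  defines "\<phi> \<equiv> \<lambda>z. cmod (dirichlet_sol (\<lambda>k. of_real (V k)) z n)"
  shows "\<phi> (Complex (E + s) \<eta>) * \<phi> (Complex (E - s) \<eta>)
     \<le> \<rho> ^ n * (4 * c\<^sup>2 / \<eta>\<^sup>2 / \<rho>)\<^sup>2 * (\<phi> (Complex E \<eta>))\<^sup>2"
    and "0 < \<rho>" and "\<rho> < 1"
proof -
  have B: "0 \<le> B" using V[of 0] by linarith
  have c: "0 < c" using s by linarith
  have "s \<le> D / 2" "0 < D" using D s B by linarith+
  then have "s\<^sup>2 \<le> D\<^sup>2 / 4" using power_mono[of s "D/2" 2] s by (auto simp: power_divide)
  then have "s\<^sup>2 / (4 * D\<^sup>2) \<le> (D\<^sup>2 / 4) / (4 * D\<^sup>2)" using \<open>0 < D\<close> by (intro divide_right_mono) auto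
  also have "\<dots> < 1" using \<open>0 < D\<close> by simp
  finally have sD: "s\<^sup>2 / (4 * D\<^sup>2) < 1" .
  then show \<rho>0: "0 < \<rho>" unfolding \<rho> by simp
  have "0 < s\<^sup>2 / (4 * D\<^sup>2)" using s \<open>0 < D\<close> by simp
  then show \<rho>1: "\<rho> < 1" unfolding \<rho> by simp
  define R where "R = dirichlet_spectrum V n"
  define R1 where "R1 = {t \<in> R. \<bar>t - E\<bar> < c}"
  define W where "W = 4 * c\<^sup>2 / \<eta>\<^sup>2"
  have "\<eta>\<^sup>2 \<le> c\<^sup>2" using \<eta> by (intro power_mono) auto
  moreover have "0 \<le> c\<^sup>2" by simp
  ultimately have "\<eta>\<^sup>2 \<le> 4 * c\<^sup>2" by linarith
  then have W1: "1 \<le> W" unfolding W_def using \<eta> by simp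
  have fin: "finite R" "card R = n" and \<phi>: "\<And>z. \<phi> z = (\<Prod>t\<in>R. cmod (z - of_real t))"
    using dirichlet_sol_factor[of V n] by (auto simp: R_def \<phi>_def)
  have fin1: "finite R1" "R1 \<subseteq> R" using fin by (auto simp: R1_def)
  have c2: "card R1 \<le> 2" unfolding R1_def R_def by (rule few_roots_near[OF lb c])
  have arg: "Complex x \<eta> - of_real t = Complex (x - t) \<eta>" for x t by (simp add: complex_eq_iff)
  have each: "cmod (Complex (E + s) \<eta> - of_real t) * cmod (Complex (E - s) \<eta> - of_real t)
     \<le> (\<rho> * (if t \<in> R1 then W / \<rho> else 1)) * (cmod (Complex E \<eta> - of_real t))\<^sup>2" if "t \<in> R" for t
  proof -
    have eq: "E + s - t = (E - t) + s" "E - s - t = (E - t) - s" by auto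
    show ?thesis
    proof (cases "t \<in> R1")
      case True
      then show ?thesis unfolding arg eq using near_factor[of "E - t" c s \<eta>] s \<eta> \<rho>0
        by (auto simp: R1_def W_def abs_minus_commute)
    next
      case False
      have "\<bar>t\<bar> \<le> B + 2" using dirichlet_spectrum_bounded[of V B t n] V that by (auto simp: R_def)
      then have "\<bar>E - t\<bar> \<le> D" using D c by linarith
      moreover have "c \<le> \<bar>E - t\<bar>" using False that by (auto simp: R1_def abs_minus_commute)
      ultimately show ?thesis unfolding arg eq using far_factor[of c "E - t" D s \<eta>] s \<eta> False
        by (auto simp: \<rho>)
    qed
  qed
  have "\<phi> (Complex (E + s) \<eta>) * \<phi> (Complex (E - s) \<eta>)
    = (\<Prod>t\<in>R. cmod (Complex (E + s) \<eta> - of_real t) * cmod (Complex (E - s) \<eta> - of_real t))"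
    by (simp add: \<phi> prod.distrib)
  also have "\<dots> \<le> (\<Prod>t\<in>R. (\<rho> * (if t \<in> R1 then W / \<rho> else 1)) * (cmod (Complex E \<eta> - of_real t))\<^sup>2)"
    by (rule prod_mono) (use each in auto)
  also have "\<dots> = \<rho> ^ n * (\<Prod>t\<in>R. if t \<in> R1 then W / \<rho> else 1) * (\<phi> (Complex E \<eta>))\<^sup>2"
    using fin by (simp add: prod.distrib \<phi> prod_power_distrib)
  also have "(\<Prod>t\<in>R. if t \<in> R1 then W / \<rho> else 1) = (W / \<rho>) ^ card R1"
    using fin fin1 by (simp add: prod.If_cases Int_absorb1)
  also have "\<rho> ^ n * (W / \<rho>) ^ card R1 * (\<phi> (Complex E \<eta>))\<^sup>2 \<le> \<rho> ^ n * (W / \<rho>)\<^sup>2 * (\<phi> (Complex E \<eta>))\<^sup>2"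
    using c2 W1 \<rho>0 \<rho>1 by (intro mult_right_mono mult_left_mono power_increasing) auto
  finally show "\<phi> (Complex (E + s) \<eta>) * \<phi> (Complex (E - s) \<eta>)
     \<le> \<rho> ^ n * (4 * c\<^sup>2 / \<eta>\<^sup>2 / \<rho>)\<^sup>2 * (\<phi> (Complex E \<eta>))\<^sup>2"
    unfolding W_def .
qed

lemma dirichlet_sol_mono_Im:
  "cmod (dirichlet_sol (\<lambda>k. complex_of_real (V k)) (of_real (Re z)) n) \<le> cmod (dirichlet_sol (\<lambda>k. of_real (V k)) z n)"
proof -
  have "cmod (of_real (Re z) - of_real t) \<le> cmod (z - of_real t)" for t
    using abs_Re_le_cmod[of "z - of_real t"] by (simp flip: of_real_diff)
  then show ?thesis using dirichlet_sol_factor[of V n] by (auto intro!: prod_mono)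
qed

section \<open>Subadditive sequences\<close>

text \<open>Fekete's lemma: by Euclidean division \<open>a n\<close> is at most \<open>(n div m) * a m\<close> plus a bounded
remainder, so the quotients converge to their infimum.\<close>

lemma fekete:
  fixes a :: "nat \<Rightarrow> real"
  assumes sub: "\<And>m n. a (m + n) \<le> a m + a n" and lb: "\<And>n. c * real n \<le> a n"
  shows "convergent (\<lambda>n. a n / real n)"
proof -
  define l where "l = (INF n\<in>{1..}. a n / real n)"
  have bdd: "bdd_below ((\<lambda>n. a n / real n) ` {1..})"
    by (rule bdd_belowI2[of _ c]) (use lb in \<open>auto simp: field_simps\<close>)
  have low: "l \<le> a n / real n" if "n \<ge> 1" for n
    unfolding l_def by (rule cINF_lower[OF bdd]) (use that in auto)
  have mult: "a (q * m + r) \<le> real q * a m + a r" for q m r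
  proof (induction q)
    case (Suc q)
    have "a (Suc q * m + r) \<le> a m + a (q * m + r)" using sub[of m "q * m + r"] by (simp add: add.assoc)
    then show ?case using Suc by (simp add: algebra_simps)
  qed simp
  have "(\<lambda>n. a n / real n) \<longlonglongrightarrow> l"
  proof (rule LIMSEQ_I)
    fix e :: real assume e: "e > 0"
    have "\<exists>m\<in>{1..}. a m / real m < l + e / 2"
      unfolding l_def using e bdd by (subst cINF_less_iff[symmetric]) auto
    then obtain m where m: "m \<ge> 1" "a m / real m < l + e / 2" by auto
    \<comment> \<open>Bounds the remainder \<open>a (n mod m)\<close> and the rounding error in \<open>n div m\<close>.\<close>
    define C where "C = (\<Sum>r<m. \<bar>a r\<bar>) + \<bar>a m\<bar> + 1"
    have C: "C > 0" unfolding C_def by (smt (verit) sum_nonneg abs_ge_zero)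
    have bound: "a n / real n \<le> a m / real m + 2 * C / real n" if "n \<ge> 1" for n
    proof -
      have "a n \<le> real (n div m) * a m + a (n mod m)" using mult[of "n div m" m "n mod m"] by simp
      also have "real (n div m) = (real n - real (n mod m)) / real m"
        using m by (simp add: field_simps flip: of_nat_mult of_nat_add)
      also have "(real n - real (n mod m)) / real m * a m = real n * (a m / real m) - real (n mod m) / real m * a m"
        using m by (simp add: diff_divide_distrib algebra_simps)
      finally have 1: "a n \<le> real n * (a m / real m) - real (n mod m) / real m * a m + a (n mod m)" .
      have 2: "- (real (n mod m) / real m * a m) \<le> \<bar>a m\<bar>"
      proof -
        have "real (n mod m) / real m \<le> 1" using m mod_less_divisor[of m n] by (simp add: field_simps)
        then have "\<bar>real (n mod m) / real m * a m\<bar> \<le> 1 * \<bar>a m\<bar>"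
          unfolding abs_mult by (intro mult_right_mono) auto
        then show ?thesis by linarith
      qed
      have "a n \<le> real n * (a m / real m) + \<bar>a m\<bar> + a (n mod m)" using 1 2 by linarith
      moreover have "\<bar>a (n mod m)\<bar> \<le> (\<Sum>r<m. \<bar>a r\<bar>)"
        using m by (intro member_le_sum) auto
      moreover have "0 \<le> (\<Sum>r<m. \<bar>a r\<bar>)" by (intro sum_nonneg) auto
      ultimately have "a n \<le> real n * (a m / real m) + 2 * C" unfolding C_def distrib_left by linarith
      then show ?thesis using that by (simp add: field_simps)
    qed
    obtain N where N: "real N > 4 * C / e" using reals_Archimedean2 by blast
    show "\<exists>N. \<forall>n\<ge>N. norm (a n / real n - l) < e"
    proof (intro exI[of _ "max N 1"] allI impI)
      fix n assume n: "max N 1 \<le> n"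
      then have n1: "n \<ge> 1" "real n > 4 * C / e" using N by auto
      then have "2 * C / real n < e / 2" using e C by (simp add: field_simps)
      then show "norm (a n / real n - l) < e" using bound[OF n1(1)] low[OF n1(1)] m by auto
    qed
  qed
  then show ?thesis by (rule convergentI)
qed

section \<open>Operator norms of transfer matrices\<close>

definition entry_sum :: "complex^2^2 \<Rightarrow> real" where
  "entry_sum A = cmod (A$1$1) + cmod (A$1$2) + cmod (A$2$1) + cmod (A$2$2)"

abbreviation opnorm :: "complex^2^2 \<Rightarrow> real" where
  "opnorm A \<equiv> onorm ((*v) A)"

lemma norm_le_sum_cmod: "norm (x :: complex^2) \<le> cmod (x$1) + cmod (x$2)"
  unfolding norm_vec_def using L2_set_le_sum[of UNIV "\<lambda>i. cmod (x $ i)"] by (simp add: sum_2)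

lemma opnorm_le_entry_sum: "opnorm A \<le> entry_sum A"
proof (rule onorm_le)
  fix x :: "complex^2"
  have c: "cmod (x $ i) \<le> norm x" for i by (rule Finite_Cartesian_Product.norm_nth_le)
  have "norm (A *v x) \<le> cmod (A$1$1 * x$1 + A$1$2 * x$2) + cmod (A$2$1 * x$1 + A$2$2 * x$2)"
    using norm_le_sum_cmod[of "A *v x"] by (simp add: matrix_vector_mult_def sum_2)
  also have "\<dots> \<le> (cmod (A$1$1) * cmod (x$1) + cmod (A$1$2) * cmod (x$2))
      + (cmod (A$2$1) * cmod (x$1) + cmod (A$2$2) * cmod (x$2))"
    by (intro add_mono order_trans[OF norm_triangle_ineq]) (auto simp: norm_mult)
  also have "\<dots> \<le> (cmod (A$1$1) * norm x + cmod (A$1$2) * norm x)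
      + (cmod (A$2$1) * norm x + cmod (A$2$2) * norm x)"
    by (intro add_mono mult_left_mono c) auto
  finally show "norm (A *v x) \<le> entry_sum A * norm x" by (simp add: entry_sum_def algebra_simps)
qed

lemma entry_le_opnorm: "cmod (A$i$j) \<le> opnorm A"
proof -
  have "cmod (A$i$j) = cmod ((A *v axis j 1) $ i)" by (simp add: matrix_vector_mul_component inner_axis
      matrix_vector_mult_def axis_def if_distrib cong: if_cong)
  also have "\<dots> \<le> norm (A *v axis j 1)" by (rule Finite_Cartesian_Product.norm_nth_le)
  also have "\<dots> \<le> opnorm A * norm (axis j 1 :: complex^2)"
    by (rule onorm[OF matrix_vector_mul_bounded_linear])
  also have "norm (axis j 1 :: complex^2) = 1"
    unfolding norm_vec_def L2_set_def axis_def by (simp add: if_distrib[of norm] if_distrib[of "\<lambda>x. x\<^sup>2"] cong: if_cong)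
  finally show ?thesis by simp
qed

lemma opnorm_mult: "opnorm (A ** B) \<le> opnorm A * opnorm B"
proof -
  have "(*v) (A ** B) = (*v) A \<circ> (*v) B" by (auto simp: matrix_vector_mul_assoc)
  then show ?thesis
    using onorm_compose[OF matrix_vector_mul_bounded_linear[of A] matrix_vector_mul_bounded_linear[of B]] by simp
qed

lemma opnorm_diff: "\<bar>opnorm A - opnorm B\<bar> \<le> entry_sum (A - B)"
proof -
  have *: "opnorm A \<le> opnorm B + entry_sum (A - B)" for A B
  proof -
    have "opnorm (B + (A - B)) \<le> opnorm B + opnorm (A - B)"
      using onorm_triangle[OF matrix_vector_mul_bounded_linear[of B] matrix_vector_mul_bounded_linear[of "A - B"]]
      by (simp add: matrix_vector_mult_add_rdistrib[abs_def] flip: matrix_vector_mult_add_rdistrib)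
    then show ?thesis using opnorm_le_entry_sum[of "A - B"] by simp
  qed
  have "entry_sum (B - A) = entry_sum (A - B)" by (simp add: entry_sum_def norm_minus_commute)
  then show ?thesis using *[of A B] *[of B A] by linarith
qed

text \<open>The optimal constant is one; any positive one makes logarithms of norms of transfer
matrices bounded below, and this one follows from comparing entries.\<close>

lemma opnorm_ge_half: 
  assumes "det A = 1"
  shows "1 / 2 \<le> opnorm A"
proof -
  let ?o = "opnorm A"
  have "1 = cmod (A$1$1 * A$2$2 - A$1$2 * A$2$1)" using assms by (simp add: det_2)
  also have "\<dots> \<le> cmod (A$1$1) * cmod (A$2$2) + cmod (A$1$2) * cmod (A$2$1)"
    by (rule order_trans[OF norm_triangle_ineq4]) (simp add: norm_mult)
  also have "\<dots> \<le> ?o * ?o + ?o * ?o"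
    by (intro add_mono mult_mono entry_le_opnorm) (auto intro: order_trans[OF norm_ge_zero entry_le_opnorm])
  finally have "1 \<le> 2 * (?o * ?o)" by simp
  moreover have "?o * ?o \<le> (1/2) * (1/2)" if "?o < 1/2"
    using that order_trans[OF norm_ge_zero entry_le_opnorm[of A 1 1]] by (intro mult_mono) auto
  ultimately show ?thesis by (cases "?o < 1/2") auto
qed

lemma entry_sum_le_opnorm: "entry_sum A \<le> 4 * opnorm A"
  unfolding entry_sum_def using entry_le_opnorm[of A 1 1] entry_le_opnorm[of A 1 2]
    entry_le_opnorm[of A 2 1] entry_le_opnorm[of A 2 2] by linarith

definition orbit_potential :: "('a \<Rightarrow> 'a) \<Rightarrow> ('a \<Rightarrow> real) \<Rightarrow> 'a \<Rightarrow> nat \<Rightarrow> real" where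
  "orbit_potential T v x k = v ((T ^^ k) x)"

lemma orbit_potential_shift: "orbit_potential T v (T x) k = orbit_potential T v x (Suc k)"
  by (simp add: orbit_potential_def funpow_swap1)

lemma transfer_matrix_entries:
  fixes T v E x
  defines "\<phi> \<equiv> \<lambda>y. dirichlet_sol (\<lambda>k. complex_of_real (orbit_potential T v y k)) E"
  shows "transfer_matrix T v E (Suc (Suc n)) x =
    vector [vector [\<phi> x (Suc (Suc n)), - \<phi> (T x) (Suc n)], vector [\<phi> x (Suc n), - \<phi> (T x) n]]"
proof (induction n)
  case 0
  show ?case
    by (simp add: vec_eq_iff forall_2 cocycle_matrix_def matrix_matrix_mult_def sum_2 mat_def \<phi>_def
        orbit_potential_def)
next
  case (Suc n)
  show ?case
    unfolding transfer_matrix.simps(2)[of T v E "Suc (Suc n)"] Suc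
    by (simp add: vec_eq_iff forall_2 cocycle_matrix_def matrix_matrix_mult_def sum_2 \<phi>_def
        orbit_potential_def funpow_swap1)
qed

lemma transfer_matrix_add:
  "transfer_matrix T v E (m + n) x = transfer_matrix T v E m ((T ^^ n) x) ** transfer_matrix T v E n x"
  by (induction m) (simp_all add: matrix_mul_assoc funpow_add)

lemma det_transfer_matrix: "det (transfer_matrix T v E n x) = 1"
proof (induction n)
  case (Suc n)
  have "det (cocycle_matrix v E y) = 1" for y by (simp add: det_2 cocycle_matrix_def)
  then show ?case using Suc by (simp add: det_mul)
qed simp

text \<open>Continuity of the operator norm in the base point is needed only to make the integrals
in the definition of the Lyapunov exponent genuine.\<close>

lemma continuous_on_opnorm:
  fixes M :: "'a::topological_space \<Rightarrow> complex^2^2"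
  assumes "\<And>i j. continuous_on S (\<lambda>x. M x $ i $ j)"
  shows "continuous_on S (\<lambda>x. opnorm (M x))"
  unfolding continuous_on_def
proof
  fix x assume x: "x \<in> S"
  have t: "((\<lambda>y. M y $ i $ j) \<longlongrightarrow> M x $ i $ j) (at x within S)" for i j
    using assms x unfolding continuous_on_def by blast
  have "((\<lambda>y. cmod ((M y - M x) $ i $ j)) \<longlongrightarrow> 0) (at x within S)" for i j
    using tendsto_norm_zero[OF LIM_zero[OF t[of i j]]] by simp
  then have "((\<lambda>y. entry_sum (M y - M x)) \<longlongrightarrow> 0) (at x within S)"
    unfolding entry_sum_def by (intro tendsto_add_zero)
  then have "((\<lambda>y. opnorm (M y) - opnorm (M x)) \<longlongrightarrow> 0) (at x within S)"
    by (rule Lim_null_comparison[rotated]) (use opnorm_diff in auto)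
  then show "((\<lambda>y. opnorm (M y)) \<longlongrightarrow> opnorm (M x)) (at x within S)"
    by (rule LIM_zero_cancel)
qed

section \<open>The Lyapunov exponent as a limit\<close>

locale ergodic_potential =
  fixes T :: "'a::metric_space \<Rightarrow> 'a" and v :: "'a \<Rightarrow> real" and \<mu> :: "'a measure"
  assumes compact_space: "compact (UNIV :: 'a set)"
    and homeo: "homeomorphism UNIV UNIV T (inv T)"
    and invariant: "invariant_prob T \<mu>"
    and cont_v: "continuous_on UNIV v"
begin

lemma cont_T: "continuous_on UNIV T" using homeo by (simp add: homeomorphism_def)

sublocale prob_space \<mu> using invariant by (simp add: invariant_prob_def)

lemma sets_mu: "sets \<mu> = sets borel" using invariant by (simp add: invariant_prob_def)

lemma cont_funpow: "continuous_on UNIV (T ^^ n)"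
proof (induction n)
  case (Suc n)
  then show ?case using continuous_on_compose2[OF cont_T Suc] by (simp add: o_def)
qed (simp add: id_def)

lemma cont_orbit_potential: "continuous_on UNIV (\<lambda>x. orbit_potential T v x k)"
  unfolding orbit_potential_def
  using continuous_on_compose[OF cont_funpow continuous_on_subset[OF cont_v]] by (auto simp: o_def)

definition vbound :: real where "vbound = (SUP x. \<bar>v x\<bar>)"

lemma v_bounded: "\<bar>v x\<bar> \<le> vbound"
proof -
  have "compact ((\<lambda>x. \<bar>v x\<bar>) ` UNIV)"
    by (intro compact_continuous_image compact_space continuous_intros cont_v)
  then have "bdd_above (range (\<lambda>x. \<bar>v x\<bar>))" by (intro bounded_imp_bdd_above compact_imp_bounded)
  then show ?thesis unfolding vbound_def by (rule cSUP_upper[rotated]) simp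
qed

lemma orbit_potential_bounded: "\<bar>orbit_potential T v x k\<bar> \<le> vbound"
  by (simp add: orbit_potential_def v_bounded)

lemma integrable_cont:
  fixes f :: "'a \<Rightarrow> real"
  assumes "continuous_on UNIV f"
  shows "integrable \<mu> f"
proof -
  have "bounded (range f)" using assms compact_space by (intro compact_imp_bounded compact_continuous_image)
  then obtain C where "\<And>x. norm (f x) \<le> C" by (auto simp: bounded_iff)
  moreover have "f \<in> borel_measurable \<mu>"
    using borel_measurable_continuous_onI[OF assms] measurable_cong_sets[OF sets_mu refl] by blast
  ultimately show ?thesis by (intro integrable_const_bound[of _ C]) auto
qed

lemma integral_funpow:
  fixes f :: "'a \<Rightarrow> real"
  assumes "continuous_on UNIV f"
  shows "(\<integral>x. f ((T ^^ n) x) \<partial>\<mu>) = (\<integral>x. f x \<partial>\<mu>)"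
  using assms
proof (induction n arbitrary: f)
  case (Suc n)
  have T: "T \<in> measurable \<mu> borel"
    using borel_measurable_continuous_onI[OF cont_T] measurable_cong_sets[OF sets_mu refl] by blast
  have "(\<integral>x. f ((T ^^ Suc n) x) \<partial>\<mu>) = (\<integral>x. f (T ((T ^^ n) x)) \<partial>\<mu>)" by simp
  also have "\<dots> = (\<integral>x. f (T x) \<partial>\<mu>)"
    by (rule Suc.IH) (use continuous_on_compose2[OF Suc.prems cont_T] in auto)
  also have "\<dots> = (\<integral>x. f x \<partial>distr \<mu> borel T)"
    by (rule integral_distr[symmetric, OF T borel_measurable_continuous_onI[OF Suc.prems]])
  also have "distr \<mu> borel T = \<mu>" using invariant by (simp add: invariant_prob_def)
  finally show ?case .
qed simp

abbreviation lognorm :: "complex \<Rightarrow> nat \<Rightarrow> 'a \<Rightarrow> real" where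
  "lognorm E n x \<equiv> ln (opnorm (transfer_matrix T v E n x))"

lemma opnorm_transfer_pos: "0 < opnorm (transfer_matrix T v E n x)"
  using opnorm_ge_half[OF det_transfer_matrix, of T v E n x] by linarith

lemma cont_lognorm: "continuous_on UNIV (lognorm E n)"
proof -
  have "continuous_on UNIV (\<lambda>x. transfer_matrix T v E n x $ i $ j)" for i j
  proof (induction n arbitrary: i j)
    case (Suc n)
    have "continuous_on UNIV (\<lambda>x. cocycle_matrix v E ((T ^^ n) x) $ i $ j)" for i j
    proof -
      have "continuous_on UNIV (\<lambda>x. v ((T ^^ n) x))"
        using cont_orbit_potential by (simp add: orbit_potential_def)
      moreover have "cocycle_matrix v E y $ i $ j =
          (if i = 1 then if j = 1 then of_real (v y) - E else - 1 else if j = 1 then 1 else 0)" for y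
        using exhaust_2[of i] exhaust_2[of j] by (auto simp: cocycle_matrix_def)
      ultimately show ?thesis by (cases "i = 1"; cases "j = 1") (auto intro!: continuous_intros)
    qed
    then show ?case using Suc
      by (auto simp: matrix_matrix_mult_def sum_2 intro!: continuous_on_add continuous_on_mult)
  qed simp
  then have "continuous_on UNIV (\<lambda>x. opnorm (transfer_matrix T v E n x))"
    by (rule continuous_on_opnorm)
  then show ?thesis
    by (rule continuous_on_ln) (metis opnorm_transfer_pos less_irrefl)
qed

definition mean_lognorm :: "complex \<Rightarrow> nat \<Rightarrow> real" where
  "mean_lognorm E n = (\<integral>x. lognorm E n x \<partial>\<mu>)"

lemma mean_lognorm_subadditive: "mean_lognorm E (m + n) \<le> mean_lognorm E m + mean_lognorm E n"
proof -
  have c: "continuous_on UNIV (\<lambda>x. lognorm E m ((T ^^ n) x))"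
    using continuous_on_compose2[OF cont_lognorm cont_funpow] by auto
  have "mean_lognorm E (m + n) \<le> (\<integral>x. lognorm E m ((T ^^ n) x) + lognorm E n x \<partial>\<mu>)"
    unfolding mean_lognorm_def
  proof (rule integral_mono)
    fix x
    have "lognorm E (m + n) x \<le> ln (opnorm (transfer_matrix T v E m ((T ^^ n) x)) * opnorm (transfer_matrix T v E n x))"
      using opnorm_transfer_pos[of E "m + n" x] opnorm_mult unfolding transfer_matrix_add by (simp add: less_le_trans)
    then show "lognorm E (m + n) x \<le> lognorm E m ((T ^^ n) x) + lognorm E n x"
      using opnorm_transfer_pos by (simp add: ln_mult_pos)
  qed (intro integrable_cont cont_lognorm continuous_intros c)+
  also have "\<dots> = (\<integral>x. lognorm E m ((T ^^ n) x) \<partial>\<mu>) + mean_lognorm E n"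
    unfolding mean_lognorm_def by (intro Bochner_Integration.integral_add integrable_cont cont_lognorm c)
  also have "(\<integral>x. lognorm E m ((T ^^ n) x) \<partial>\<mu>) = mean_lognorm E m"
    unfolding mean_lognorm_def by (rule integral_funpow[OF cont_lognorm])
  finally show ?thesis .
qed

abbreviation L :: "complex \<Rightarrow> real" where "L \<equiv> lyapunov T v \<mu>"

lemma lyapunov_tendsto: "(\<lambda>n. mean_lognorm E n / real n) \<longlonglongrightarrow> L E"
proof -
  have one: "opnorm (mat 1 :: complex^2^2) = 1"
  proof -
    have "(*v) (mat 1 :: complex^2^2) = (\<lambda>x. x)" by auto
    then show ?thesis by (simp add: onorm_id)
  qed
  have lb: "- ln 2 * real n \<le> mean_lognorm E n" for n
  proof (cases n)
    case 0 then show ?thesis by (simp add: mean_lognorm_def one)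
  next
    case (Suc m)
    have "- ln 2 \<le> lognorm E n x" for x
    proof -
      have "ln (1 / 2) \<le> lognorm E n x"
        using opnorm_ge_half[OF det_transfer_matrix, of T v E n x] by (subst ln_le_cancel_iff) auto
      then show ?thesis by (simp add: ln_div)
    qed
    then have "(\<integral>x. - ln 2 \<partial>\<mu>) \<le> mean_lognorm E n"
      unfolding mean_lognorm_def by (intro integral_mono integrable_cont cont_lognorm) auto
    then have "- ln 2 \<le> mean_lognorm E n" by (simp add: prob_space)
    moreover have "- ln 2 * real n \<le> - ln 2 * (1::real)" using Suc by simp
    ultimately show ?thesis by linarith
  qed
  have "convergent (\<lambda>n. mean_lognorm E n / real n)"
    by (rule fekete[OF mean_lognorm_subadditive lb])
  moreover have "L E = lim (\<lambda>n. mean_lognorm E n / real n)"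
    unfolding lyapunov_def mean_lognorm_def by simp
  ultimately show ?thesis by (simp add: convergent_LIMSEQ_iff)
qed

section \<open>Monotonicity, growth and concavity of the Lyapunov exponent\<close>

abbreviation \<phi> :: "complex \<Rightarrow> 'a \<Rightarrow> nat \<Rightarrow> complex" where
  "\<phi> E x \<equiv> dirichlet_sol (\<lambda>k. complex_of_real (orbit_potential T v x k)) E"

lemma entry_sum_transfer:
  "entry_sum (transfer_matrix T v E (Suc (Suc n)) x) =
     cmod (\<phi> E x (Suc (Suc n))) + cmod (\<phi> E (T x) (Suc n)) + cmod (\<phi> E x (Suc n)) + cmod (\<phi> E (T x) n)"
  unfolding transfer_matrix_entries entry_sum_def by simp

lemma phi_le_opnorm: "cmod (\<phi> E x (Suc (Suc n))) \<le> opnorm (transfer_matrix T v E (Suc (Suc n)) x)"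
  using entry_le_opnorm[of "transfer_matrix T v E (Suc (Suc n)) x" 1 1] unfolding transfer_matrix_entries by simp

text \<open>Off the real axis a single entry controls the whole matrix: removing a site at either end of
the box shrinks the determinant at most by the factor \<open>1 / Im E\<close>.\<close>

lemma opnorm_le_phi:
  assumes "Im E > 0"
  shows "opnorm (transfer_matrix T v E (Suc (Suc n)) x) \<le> (1 + 1 / Im E)\<^sup>2 * cmod (\<phi> E x (Suc (Suc n)))"
proof -
  let ?e = "Im E" and ?p = "cmod (\<phi> E x (Suc (Suc n)))"
  have r: "cmod (\<phi> E y m) \<le> cmod (\<phi> E y (Suc m)) / ?e" for y m
    using dirichlet_sol_norm_right[OF assms, of "orbit_potential T v y" m] assms by (simp add: field_simps)
  have l: "cmod (\<phi> E (T y) m) \<le> cmod (\<phi> E y (Suc m)) / ?e" for y m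
    using dirichlet_sol_norm_left[OF assms, of "orbit_potential T v y" m] assms
    by (simp add: field_simps orbit_potential_shift)
  have "cmod (\<phi> E (T x) n) \<le> cmod (\<phi> E (T x) (Suc n)) / ?e" by (rule r)
  also have "\<dots> \<le> ?p / ?e / ?e" using l[of x "Suc n"] assms by (intro divide_right_mono) auto
  finally have "entry_sum (transfer_matrix T v E (Suc (Suc n)) x) \<le> ?p + ?p / ?e + ?p / ?e + ?p / ?e / ?e"
    unfolding entry_sum_transfer using l[of x "Suc n"] r[of x "Suc n"] by linarith
  also have "\<dots> = (1 + 1 / ?e)\<^sup>2 * ?p" using assms by (simp add: field_simps power2_eq_square)
  finally show ?thesis using opnorm_le_entry_sum order_trans by blast
qed

text \<open>Each entry of the transfer matrix is a product of distances to real points, so its modulus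
decreases when the argument is projected to the real axis.  Norms of matrices are compared with
sums of moduli of entries at the cost of the factor four, which disappears in the limit.\<close>

lemma lyapunov_Re_le: "L (of_real (Re z)) \<le> L z"
proof -
  have "mean_lognorm (of_real (Re z)) n \<le> mean_lognorm z n + ln 4" if n: "n \<ge> 2" for n
  proof -
    obtain m where m: "n = Suc (Suc m)" using n by (metis add_2_eq_Suc le_Suc_ex)
    have "lognorm (of_real (Re z)) n x \<le> lognorm z n x + ln 4" for x
    proof -
      have "opnorm (transfer_matrix T v (of_real (Re z)) n x) \<le> entry_sum (transfer_matrix T v (of_real (Re z)) n x)"
        by (rule opnorm_le_entry_sum)
      also have "\<dots> \<le> entry_sum (transfer_matrix T v z n x)"
        unfolding m entry_sum_transfer by (intro add_mono dirichlet_sol_mono_Im)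
      also have "\<dots> \<le> 4 * opnorm (transfer_matrix T v z n x)" by (rule entry_sum_le_opnorm)
      finally have "lognorm (of_real (Re z)) n x \<le> ln (4 * opnorm (transfer_matrix T v z n x))"
        using opnorm_transfer_pos by (subst ln_le_cancel_iff) auto
      then show ?thesis using opnorm_transfer_pos by (simp add: ln_mult_pos)
    qed
    then have "mean_lognorm (of_real (Re z)) n \<le> (\<integral>x. lognorm z n x + ln 4 \<partial>\<mu>)"
      unfolding mean_lognorm_def
      by (intro integral_mono integrable_cont continuous_intros cont_lognorm) auto
    also have "\<dots> = mean_lognorm z n + ln 4"
      unfolding mean_lognorm_def
      by (subst Bochner_Integration.integral_add) (auto intro!: integrable_cont cont_lognorm simp: prob_space)
    finally show ?thesis .
  qed
  then have ev: "\<forall>n\<ge>2. mean_lognorm (of_real (Re z)) n / real n \<le> mean_lognorm z n / real n + ln 4 / real n"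
    by (auto simp: divide_right_mono simp flip: add_divide_distrib)
  have "(\<lambda>n. mean_lognorm z n / real n + ln 4 / real n) \<longlonglongrightarrow> L z + 0"
    by (intro tendsto_add lyapunov_tendsto lim_const_over_n)
  then show ?thesis using LIMSEQ_le[OF lyapunov_tendsto] ev by fastforce
qed

lemma lyapunov_growth:
  assumes K: "1 \<le> K" and t: "vbound + 1 + K \<le> cmod z"
  shows "ln K \<le> L z"
proof -
  have "real n * ln K \<le> mean_lognorm z n" if n: "n \<ge> 2" for n
  proof -
    obtain m where m: "n = Suc (Suc m)" using n by (metis add_2_eq_Suc le_Suc_ex)
    have "real n * ln K \<le> lognorm z n x" for x
    proof -
      have pow: "K ^ j \<le> cmod (\<phi> z x j)" for j
      proof (induction j)
        case (Suc j)
        have "K * K ^ j \<le> K * cmod (\<phi> z x j)" using Suc K by (intro mult_left_mono) auto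
        also have "\<dots> \<le> cmod (\<phi> z x (Suc j))"
          by (rule conjunct1[OF dirichlet_sol_large[OF _ K t]]) (use orbit_potential_bounded in auto)
        finally show ?case by simp
      qed simp
      have "K ^ n \<le> opnorm (transfer_matrix T v z n x)"
        unfolding m using pow[of "Suc (Suc m)"] phi_le_opnorm[of x z m] by linarith
      then have "ln (K ^ n) \<le> lognorm z n x" using K opnorm_transfer_pos by (subst ln_le_cancel_iff) auto
      then show ?thesis using K by (simp add: ln_realpow)
    qed
    then have "(\<integral>x. real n * ln K \<partial>\<mu>) \<le> mean_lognorm z n"
      unfolding mean_lognorm_def by (intro integral_mono integrable_cont cont_lognorm) auto
    then show ?thesis by (simp add: prob_space)
  qed
  then have "\<forall>n\<ge>2. ln K \<le> mean_lognorm z n / real n" by (auto simp: field_simps)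
  then show ?thesis using LIMSEQ_le_const[OF lyapunov_tendsto] by blast
qed

text \<open>At a fixed height \<open>\<eta>\<close> every loss (the comparison of entries with the operator norm and the at most two
eigenvalues near \<open>E\<close>) is a constant \<open>K\<close> independent of \<open>n\<close>, whereas the gain is \<open>n * ln \<rho>\<close>.\<close>

lemma lyapunov_midpoint_Im:
  assumes lb: "\<And>x. bounded_below_at c E (orbit_potential T v x)"
    and D: "D = \<bar>E\<bar> + vbound + 2 + c" and s: "0 < s" "s \<le> c / 2" and \<eta>: "0 < \<eta>" "\<eta> \<le> c / 2"
    and \<rho>: "\<rho> = sqrt (1 - s\<^sup>2 / (4 * D\<^sup>2))"
  shows "L (Complex (E + s) \<eta>) + L (Complex (E - s) \<eta>) \<le> 2 * L (Complex E \<eta>) + ln \<rho>"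
proof -
  define W where "W = (4 * c\<^sup>2 / \<eta>\<^sup>2 / \<rho>)\<^sup>2"
  define C where "C = (1 + 1 / \<eta>)\<^sup>2"
  have \<rho>01: "0 < \<rho>" "\<rho> < 1"
    using dirichlet_sol_midpoint(2,3)[OF lb orbit_potential_bounded D s \<eta> \<rho>] by auto
  have W: "W > 0" unfolding W_def using s \<eta> \<rho>01 by simp
  have C: "C > 0" unfolding C_def using \<eta> by (intro zero_less_power) (simp add: add_pos_pos)
  define K where "K = ln (C * C * W)"
  have "mean_lognorm (Complex (E + s) \<eta>) n + mean_lognorm (Complex (E - s) \<eta>) n
     \<le> 2 * mean_lognorm (Complex E \<eta>) n + (real n * ln \<rho> + K)" if n: "n \<ge> 2" for n
  proof -
    obtain m where m: "n = Suc (Suc m)" using n by (metis add_2_eq_Suc le_Suc_ex)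
    have pt: "lognorm (Complex (E + s) \<eta>) n x + lognorm (Complex (E - s) \<eta>) n x
       \<le> 2 * lognorm (Complex E \<eta>) n x + (real n * ln \<rho> + K)" for x
    proof -
      let ?M = "\<lambda>z. opnorm (transfer_matrix T v z n x)"
      have pos: "?M z > 0" for z by (rule opnorm_transfer_pos)
      have "?M (Complex (E + s) \<eta>) * ?M (Complex (E - s) \<eta>)
          \<le> (C * cmod (\<phi> (Complex (E + s) \<eta>) x n)) * (C * cmod (\<phi> (Complex (E - s) \<eta>) x n))"
      proof (rule mult_mono)
        show "?M (Complex (E + s) \<eta>) \<le> C * cmod (\<phi> (Complex (E + s) \<eta>) x n)"
          "?M (Complex (E - s) \<eta>) \<le> C * cmod (\<phi> (Complex (E - s) \<eta>) x n)"
          unfolding m C_def using opnorm_le_phi[of "Complex (E + s) \<eta>" m x]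
            opnorm_le_phi[of "Complex (E - s) \<eta>" m x] \<eta> by (simp_all only: complex.sel)
        show "0 \<le> C * cmod (\<phi> (Complex (E + s) \<eta>) x n)" using C by simp
        show "0 \<le> ?M (Complex (E - s) \<eta>)" using pos less_imp_le by blast
      qed
      also have "\<dots> = C * C * (cmod (\<phi> (Complex (E + s) \<eta>) x n) * cmod (\<phi> (Complex (E - s) \<eta>) x n))"
        by simp
      also have "\<dots> \<le> C * C * (\<rho> ^ n * W * (cmod (\<phi> (Complex E \<eta>) x n))\<^sup>2)"
        unfolding W_def using C dirichlet_sol_midpoint(1)[OF lb orbit_potential_bounded D s \<eta> \<rho>]
        by (intro mult_left_mono) auto
      also have "\<dots> \<le> C * C * (\<rho> ^ n * W * (?M (Complex E \<eta>))\<^sup>2)"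
        using C W \<rho>01 phi_le_opnorm[of x "Complex E \<eta>" m] unfolding m
        by (intro mult_left_mono power_mono) auto
      finally have "?M (Complex (E + s) \<eta>) * ?M (Complex (E - s) \<eta>)
          \<le> (C * C * W) * \<rho> ^ n * (?M (Complex E \<eta>))\<^sup>2" by (simp add: ac_simps)
      moreover have "0 < (C * C * W) * \<rho> ^ n * (?M (Complex E \<eta>))\<^sup>2"
        by (intro mult_pos_pos zero_less_power C W \<rho>01 pos)
      ultimately have "ln (?M (Complex (E + s) \<eta>) * ?M (Complex (E - s) \<eta>))
          \<le> ln ((C * C * W) * \<rho> ^ n * (?M (Complex E \<eta>))\<^sup>2)"
        using pos by (subst ln_le_cancel_iff) auto
      also have "\<dots> = ln ((C * C * W) * \<rho> ^ n) + ln ((?M (Complex E \<eta>))\<^sup>2)"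
        by (rule ln_mult_pos) (intro mult_pos_pos zero_less_power C W \<rho>01 pos)+
      also have "ln ((C * C * W) * \<rho> ^ n) = K + real n * ln \<rho>"
        unfolding K_def using C W \<rho>01 by (subst ln_mult_pos) (auto simp: ln_realpow)
      also have "ln ((?M (Complex E \<eta>))\<^sup>2) = 2 * ln (?M (Complex E \<eta>))"
        by (simp add: ln_realpow)
      finally show ?thesis using pos by (simp add: ln_mult_pos)
    qed
    have "mean_lognorm (Complex (E + s) \<eta>) n + mean_lognorm (Complex (E - s) \<eta>) n
      = (\<integral>x. lognorm (Complex (E + s) \<eta>) n x + lognorm (Complex (E - s) \<eta>) n x \<partial>\<mu>)"
      unfolding mean_lognorm_def
      by (intro Bochner_Integration.integral_add[symmetric] integrable_cont cont_lognorm)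
    also have "\<dots> \<le> (\<integral>x. 2 * lognorm (Complex E \<eta>) n x + (real n * ln \<rho> + K) \<partial>\<mu>)"
      by (intro integral_mono integrable_cont continuous_intros cont_lognorm pt)
    also have "\<dots> = 2 * mean_lognorm (Complex E \<eta>) n + (real n * ln \<rho> + K)"
      unfolding mean_lognorm_def
      by (subst Bochner_Integration.integral_add)
        (auto intro!: integrable_cont cont_lognorm continuous_intros simp: prob_space)
    finally show ?thesis .
  qed
  note mean = this
  have ev: "mean_lognorm (Complex (E + s) \<eta>) n / real n + mean_lognorm (Complex (E - s) \<eta>) n / real n
      \<le> 2 * (mean_lognorm (Complex E \<eta>) n / real n) + ln \<rho> + K / real n" if "n \<ge> 2" for n
    using divide_right_mono[OF mean[OF that], of "real n"] that by (simp add: add_divide_distrib)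
  have "(\<lambda>n. 2 * (mean_lognorm (Complex E \<eta>) n / real n) + ln \<rho> + K / real n)
      \<longlonglongrightarrow> 2 * L (Complex E \<eta>) + ln \<rho> + 0"
    by (intro tendsto_intros lyapunov_tendsto lim_const_over_n)
  moreover have "(\<lambda>n. mean_lognorm (Complex (E + s) \<eta>) n / real n + mean_lognorm (Complex (E - s) \<eta>) n / real n)
     \<longlonglongrightarrow> L (Complex (E + s) \<eta>) + L (Complex (E - s) \<eta>)"
    by (intro tendsto_intros lyapunov_tendsto)
  ultimately have "L (Complex (E + s) \<eta>) + L (Complex (E - s) \<eta>) \<le> 2 * L (Complex E \<eta>) + ln \<rho> + 0"
    using LIMSEQ_le ev by blast
  then show ?thesis by simp
qed

text \<open>The gain \<open>ln \<rho>\<close> does not depend on \<open>\<eta>\<close>, so it survives the limit \<open>\<eta> \<longlongrightarrow> 0\<close>.\<close>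

lemma lyapunov_midpoint:
  assumes lb: "\<And>x. bounded_below_at c E (orbit_potential T v x)"
    and cL: "continuous_on UNIV L" and s: "0 < s" "s \<le> c / 2"
  shows "L (of_real (E + s)) + L (of_real (E - s)) < 2 * L (of_real E)"
proof -
  define D where "D = \<bar>E\<bar> + vbound + 2 + c"
  define \<rho> where "\<rho> = sqrt (1 - s\<^sup>2 / (4 * D\<^sup>2))"
  have "0 < \<rho>" "\<rho> < 1"
    using dirichlet_sol_midpoint(2,3)[OF lb orbit_potential_bounded D_def s s \<rho>_def] by auto
  then have neg: "ln \<rho> < 0" by simp
  have lim: "((\<lambda>\<eta>. L (Complex t \<eta>)) \<longlongrightarrow> L (of_real t)) (at_right 0)" for t
  proof -
    have "((\<lambda>\<eta>. Complex t \<eta>) \<longlongrightarrow> Complex t 0) (at_right 0)"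
      by (intro tendsto_Complex tendsto_intros)
    moreover have "isCont L (Complex t 0)" using cL by (simp add: continuous_on_eq_continuous_at)
    ultimately show ?thesis using isCont_tendsto_compose by (fastforce simp: complex_of_real_def)
  qed
  have "L (of_real (E + s)) + L (of_real (E - s)) \<le> 2 * L (of_real E) + ln \<rho>"
  proof (rule tendsto_le)
    show "\<forall>\<^sub>F \<eta> in at_right 0. L (Complex (E + s) \<eta>) + L (Complex (E - s) \<eta>) \<le> 2 * L (Complex E \<eta>) + ln \<rho>"
      unfolding eventually_at_right_field
      using lyapunov_midpoint_Im[OF lb D_def s _ _ \<rho>_def] s by (intro exI[of _ "c/2"]) auto
  qed (auto intro!: tendsto_intros lim simp del: of_real_add of_real_diff)
  then show ?thesis using neg by linarith
qed

end

section \<open>The spectrum of a discrete Schroedinger operator\<close>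

text \<open>A bound on all finite sections of the norm.  It expresses membership in \<open>l2\<close> together with a norm estimate
and passes to pointwise limits, which replaces completeness of \<open>l2\<close> in the construction of the resolvent.\<close>

definition l2_bound :: "real \<Rightarrow> (int \<Rightarrow> complex) \<Rightarrow> bool" where
  "l2_bound S u \<longleftrightarrow> (\<forall>F. finite F \<longrightarrow> L2_set (\<lambda>n. cmod (u n)) F \<le> S)"

lemma l2_bound_nonneg: "l2_bound S u \<Longrightarrow> 0 \<le> S"
  unfolding l2_bound_def by (metis L2_set_empty finite.emptyI)

lemma l2_bound_norm: assumes "u \<in> l2" shows "l2_bound (l2_norm u) u"
proof -
  have "L2_set (\<lambda>n. cmod (u n)) F \<le> l2_norm u" if "finite F" for F
    unfolding L2_set_def l2_norm_def
    using assms that by (intro real_sqrt_le_mono finite_sum_le_infsum) (auto simp: l2_def)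
  then show ?thesis by (simp add: l2_bound_def)
qed

lemma l2_bound_l2: assumes "l2_bound S u" shows "u \<in> l2" "l2_norm u \<le> S"
proof -
  have S: "0 \<le> S" using l2_bound_nonneg[OF assms] .
  have b: "(\<Sum>n\<in>F. (cmod (u n))\<^sup>2) \<le> S\<^sup>2" if "finite F" for F
  proof -
    have "(L2_set (\<lambda>n. cmod (u n)) F)\<^sup>2 \<le> S\<^sup>2"
      using assms that by (intro power_mono) (auto simp: l2_bound_def)
    then show ?thesis by (simp add: L2_set_def sum_nonneg)
  qed
  have "(\<lambda>n. (cmod (u n))\<^sup>2) summable_on UNIV"
  proof (rule nonneg_bdd_above_summable_on)
    show "bdd_above (sum (\<lambda>n. (cmod (u n))\<^sup>2) ` {F. F \<subseteq> UNIV \<and> finite F})"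
      by (rule bdd_aboveI2[where M = "S\<^sup>2"]) (simp add: b)
  qed simp
  then show 1: "u \<in> l2" by (simp add: l2_def)
  have "(\<Sum>\<^sub>\<infinity>n. (cmod (u n))\<^sup>2) \<le> S\<^sup>2"
  proof (rule infsum_le_finite_sums)
    show "(\<lambda>n. (cmod (u n))\<^sup>2) summable_on UNIV" using 1 by (simp add: l2_def)
  qed (rule b)
  then show "l2_norm u \<le> S" unfolding l2_norm_def using real_le_lsqrt[OF S] by blast
qed

lemma l2_bound_point: "l2_bound S u \<Longrightarrow> cmod (u n) \<le> S"
  unfolding l2_bound_def by (drule spec[of _ "{n}"]) (simp add: L2_set_def)

lemma l2_bound_add: "l2_bound S u \<Longrightarrow> l2_bound S' w \<Longrightarrow> l2_bound (S + S') (\<lambda>n. u n + w n)"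
  unfolding l2_bound_def
proof (intro allI impI)
  fix F :: "int set" assume a: "\<forall>F. finite F \<longrightarrow> L2_set (\<lambda>n. cmod (u n)) F \<le> S"
    "\<forall>F. finite F \<longrightarrow> L2_set (\<lambda>n. cmod (w n)) F \<le> S'" "finite F"
  have "L2_set (\<lambda>n. cmod (u n + w n)) F \<le> L2_set (\<lambda>n. cmod (u n) + cmod (w n)) F"
    by (intro L2_set_mono norm_triangle_ineq) auto
  also have "\<dots> \<le> L2_set (\<lambda>n. cmod (u n)) F + L2_set (\<lambda>n. cmod (w n)) F" by (rule L2_set_triangle_ineq)
  finally show "L2_set (\<lambda>n. cmod (u n + w n)) F \<le> S + S'" using a by fastforce
qed

lemma l2_bound_mult:
  assumes "l2_bound S u" "\<And>n. cmod (a n) \<le> A" shows "l2_bound (A * S) (\<lambda>n. a n * u n)"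
  unfolding l2_bound_def
proof (intro allI impI)
  fix F :: "int set" assume F: "finite F"
  have A: "0 \<le> A" using assms(2)[of 0] norm_ge_zero order_trans by blast
  have "L2_set (\<lambda>n. cmod (a n * u n)) F \<le> L2_set (\<lambda>n. A * cmod (u n)) F"
    using assms by (intro L2_set_mono) (auto simp: norm_mult mult_right_mono)
  also have "\<dots> = A * L2_set (\<lambda>n. cmod (u n)) F" using A by (simp add: L2_set_right_distrib)
  also have "\<dots> \<le> A * S" using assms F A by (intro mult_left_mono) (auto simp: l2_bound_def)
  finally show "L2_set (\<lambda>n. cmod (a n * u n)) F \<le> A * S" .
qed

lemma l2_bound_shift: assumes "l2_bound S u" shows "l2_bound S (\<lambda>n. u (n + k))"
  unfolding l2_bound_def
proof (intro allI impI)
  fix F :: "int set" assume F: "finite F"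
  have "L2_set (\<lambda>n. cmod (u (n + k))) F = L2_set (\<lambda>n. cmod (u n)) ((\<lambda>n. n + k) ` F)"
    unfolding L2_set_def by (subst sum.reindex) (auto simp: inj_on_def)
  also have "\<dots> \<le> S" using assms F by (auto simp: l2_bound_def)
  finally show "L2_set (\<lambda>n. cmod (u (n + k))) F \<le> S" .
qed

lemma l2_bound_mono: "l2_bound S u \<Longrightarrow> S \<le> S' \<Longrightarrow> l2_bound S' u"
  unfolding l2_bound_def by force

lemma l2_bound_limit:
  assumes "\<And>N. l2_bound S (s N)" "\<And>n. (\<lambda>N. s N n) \<longlonglongrightarrow> u n"
  shows "l2_bound S u"
  unfolding l2_bound_def
proof (intro allI impI)
  fix F :: "int set" assume F: "finite F"
  have "(\<lambda>N. L2_set (\<lambda>n. cmod (s N n)) F) \<longlonglongrightarrow> L2_set (\<lambda>n. cmod (u n)) F"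
    unfolding L2_set_def by (intro tendsto_intros assms(2))
  then show "L2_set (\<lambda>n. cmod (u n)) F \<le> S"
    by (rule LIMSEQ_le_const2) (use assms(1) F in \<open>auto simp: l2_bound_def\<close>)
qed

text \<open>The Neumann series \<open>- (\<Sum>k. H^k / E^(k+1))\<close>, taken pointwise, is a bounded inverse.\<close>

lemma large_not_in_spectrum:
  fixes V :: "int \<Rightarrow> real"
  assumes V: "\<And>n. \<bar>V n\<bar> \<le> B" and E: "2 * (2 + B) < cmod E"
  defines "H \<equiv> \<lambda>u n. - u (n + 1) - u (n - 1) + complex_of_real (V n) * u n"
  shows "E \<notin> l2_spectrum H"
proof -
  define K where "K = 2 + B"
  have B: "0 \<le> B" using V[of 0] by linarith
  have K: "2 \<le> K" "2 * K < cmod E" using B E by (auto simp: K_def)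
  then have E0: "E \<noteq> 0" by auto
  then have kE: "K / cmod E \<le> 1/2" using K(2) by (simp add: divide_le_eq)
  have H_bound: "l2_bound (K * S) (H u)" if "l2_bound S u" for S u
  proof -
    have a: "l2_bound (1 * S) (\<lambda>n. (-1) * u (n + 1))"
      by (rule l2_bound_mult[OF l2_bound_shift[OF that]]) simp
    have b: "l2_bound (1 * S) (\<lambda>n. (-1) * u (n + (- 1)))"
      by (rule l2_bound_mult[OF l2_bound_shift[OF that]]) simp
    have c: "l2_bound (B * S) (\<lambda>n. complex_of_real (V n) * u n)"
      by (rule l2_bound_mult[OF that]) (simp add: V)
    show ?thesis using l2_bound_add[OF l2_bound_add[OF a b] c] by (simp add: H_def K_def algebra_simps)
  qed
  have Hk_bound: "l2_bound (K ^ k * S) ((H ^^ k) u)" if "l2_bound S u" for S u k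
  proof (induction k)
    case (Suc k) then show ?case using H_bound[OF Suc] by (simp add: ac_simps)
  qed (simp add: that)
  have Hk_add: "(H ^^ k) (\<lambda>n. u n + w n) = (\<lambda>n. (H ^^ k) u n + (H ^^ k) w n)" for k u w
    by (induction k) (auto simp: H_def algebra_simps)
  have Hk_mult: "(H ^^ k) (\<lambda>n. c * u n) = (\<lambda>n. c * (H ^^ k) u n)" for k u c
    by (induction k) (auto simp: H_def algebra_simps)
  have Hk_res: "(H ^^ k) (\<lambda>n. H u n - E * u n) = (\<lambda>n. (H ^^ Suc k) u n - E * (H ^^ k) u n)" for k u
    using Hk_add[of k "H u" "\<lambda>n. (- E) * u n"] Hk_mult[of k "- E" u] by (simp add: funpow_swap1)
  define R where "R = (\<lambda>f n. \<Sum>k. - ((H ^^ k) f n / E ^ Suc k))"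
  have geo: "norm (- ((H ^^ k) f n / E ^ Suc k)) \<le> S * (1/2) ^ Suc k" if "l2_bound S f" for S f n k
  proof -
    have S: "0 \<le> S" using l2_bound_nonneg[OF that] .
    have "cmod ((H ^^ k) f n) \<le> K ^ k * S" using l2_bound_point[OF Hk_bound[OF that]] .
    also have "\<dots> \<le> K ^ Suc k * S" using K S by (intro mult_right_mono power_increasing) auto
    finally have "cmod ((H ^^ k) f n) / cmod E ^ Suc k \<le> K ^ Suc k * S / cmod E ^ Suc k"
      by (intro divide_right_mono) auto
    also have "\<dots> = (K / cmod E) ^ Suc k * S" by (simp add: power_divide)
    also have "\<dots> \<le> (1/2) ^ Suc k * S"
      using K S kE by (intro mult_right_mono power_mono) auto
    finally show ?thesis by (simp add: norm_divide norm_power norm_mult ac_simps)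
  qed
  have summ: "summable (\<lambda>k. - ((H ^^ k) f n / E ^ Suc k))" if "l2_bound S f" for S f n
  proof (rule summable_comparison_test')
    show "summable (\<lambda>k. S * (1/2) ^ Suc k)"
      by (intro summable_mult) (simp add: summable_geometric)
  qed (use geo[OF that] in auto)
  have R_bound: "l2_bound S (R f)" if f: "l2_bound S f" for S f
  proof (rule l2_bound_limit)
    have S: "0 \<le> S" using l2_bound_nonneg[OF f] .
    show "(\<lambda>N. \<Sum>k<N. - ((H ^^ k) f n / E ^ Suc k)) \<longlonglongrightarrow> R f n" for n
      unfolding R_def by (rule summable_LIMSEQ[OF summ[OF f]])
    have trm: "l2_bound (S * (1/2) ^ Suc k) (\<lambda>n. - ((H ^^ k) f n / E ^ Suc k))" for k
    proof -
      have "l2_bound (1 / cmod E ^ Suc k * (K ^ k * S)) (\<lambda>n. - (1 / E ^ Suc k) * (H ^^ k) f n)"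
        by (rule l2_bound_mult[OF Hk_bound[OF f]]) (simp add: norm_divide norm_power norm_mult)
      moreover have "1 / cmod E ^ Suc k * (K ^ k * S) \<le> S * (1/2) ^ Suc k"
      proof -
        have "K ^ k * S \<le> K ^ Suc k * S" using K S by (intro mult_right_mono power_increasing) auto
        then have "1 / cmod E ^ Suc k * (K ^ k * S) \<le> 1 / cmod E ^ Suc k * (K ^ Suc k * S)"
          by (intro mult_left_mono) auto
        also have "\<dots> = (K / cmod E) ^ Suc k * S" by (simp add: power_divide)
        also have "\<dots> \<le> (1/2) ^ Suc k * S"
          using K S kE by (intro mult_right_mono power_mono) auto
        finally show ?thesis by (simp add: ac_simps)
      qed
      ultimately have "l2_bound (S * (1/2) ^ Suc k) (\<lambda>n. - (1 / E ^ Suc k) * (H ^^ k) f n)"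
        by (rule l2_bound_mono)
      then show ?thesis by simp
    qed
    have part: "l2_bound (S * (1 - (1/2) ^ N)) (\<lambda>n. \<Sum>k<N. - ((H ^^ k) f n / E ^ Suc k))" for N
    proof (induction N)
      case 0 show ?case by (simp add: l2_bound_def L2_set_def)
    next
      case (Suc N)
      have "l2_bound (S * (1 - (1/2) ^ N) + S * (1/2) ^ Suc N)
         (\<lambda>n. (\<Sum>k<N. - ((H ^^ k) f n / E ^ Suc k)) + - ((H ^^ N) f n / E ^ Suc N))"
        by (rule l2_bound_add[OF Suc trm])
      moreover have "S * (1 - (1/2) ^ N) + S * (1/2) ^ Suc N = S * (1 - (1/2) ^ Suc N)"
        by (simp add: algebra_simps)
      ultimately show ?case by simp
    qed
    show "l2_bound S (\<lambda>n. \<Sum>k<N. - ((H ^^ k) f n / E ^ Suc k))" for N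
      by (rule l2_bound_mono[OF part]) (use S in \<open>simp add: mult_left_le\<close>)
  qed
  have R_add: "R (\<lambda>n. u n + w n) = (\<lambda>n. R u n + R w n)" if "u \<in> l2" "w \<in> l2" for u w
    unfolding R_def Hk_add
    using suminf_add[OF summ[OF l2_bound_norm[OF that(1)]] summ[OF l2_bound_norm[OF that(2)]]]
    by (simp add: add_divide_distrib add.commute)
  have R_mult: "R (\<lambda>n. c * u n) = (\<lambda>n. c * R u n)" if "u \<in> l2" for u c
    unfolding R_def Hk_mult
    using suminf_mult[OF summ[OF l2_bound_norm[OF that]], of c] by simp
  have left: "R (\<lambda>n. H u n - E * u n) = u" if "u \<in> l2" for u
  proof
    fix n
    have S: "l2_bound (l2_norm u) u" by (rule l2_bound_norm[OF that])
    define a where "a k = (H ^^ k) u n / E ^ k" for k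
    have "(\<lambda>k. - E * - ((H ^^ k) u n / E ^ Suc k)) \<longlonglongrightarrow> - E * 0"
      by (intro tendsto_mult tendsto_const summable_LIMSEQ_zero[OF summ[OF S]])
    then have "a \<longlonglongrightarrow> 0" using E0 by (simp add: a_def[abs_def] field_simps)
    then have "(\<lambda>k. a (Suc k) - a k) sums (0 - a 0)" by (rule telescope_sums)
    then have "(\<lambda>k. - (a (Suc k) - a k)) sums (- (0 - a 0))" by (rule sums_minus)
    moreover have "- (a (Suc k) - a k) = - ((H ^^ k) (\<lambda>n. H u n - E * u n) n / E ^ Suc k)" for k
      unfolding Hk_res a_def using E0 by (simp add: field_simps)
    ultimately show "R (\<lambda>n. H u n - E * u n) n = u n"
      unfolding R_def by (simp add: sums_iff a_def)
  qed
  have right: "(\<lambda>n. H (R u) n - E * R u n) = u" if "u \<in> l2" for u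
  proof
    fix n
    have S: "l2_bound (l2_norm u) u" by (rule l2_bound_norm[OF that])
    let ?t = "\<lambda>n k. - ((H ^^ k) u n / E ^ Suc k)"
    have sm: "?t n sums R u n" for n unfolding R_def using summ[OF S] summable_sums by blast
    have "(\<lambda>k. - ?t (n + 1) k - ?t (n - 1) k + of_real (V n) * ?t n k) sums
        (- R u (n + 1) - R u (n - 1) + of_real (V n) * R u n)"
      by (intro sums_add sums_diff sums_minus sums_mult sm)
    moreover have "- ?t (n + 1) k - ?t (n - 1) k + of_real (V n) * ?t n k = E * ?t n (Suc k)" for k
      using E0 by (simp add: H_def field_simps)
    ultimately have "(\<lambda>k. E * ?t n (Suc k)) sums H (R u) n" by (simp add: H_def)
    moreover have "(\<lambda>k. E * ?t n (Suc k)) sums (E * R u n - E * ?t n 0)"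
      using sums_mult[OF sm, of E] by (subst sums_Suc_iff) simp
    ultimately have "H (R u) n = E * R u n - E * ?t n 0" by (rule sums_unique2)
    then show "H (R u) n - E * R u n = u n" using E0 by simp
  qed
  have "l2_bounded_operator R"
    unfolding l2_bounded_operator_def
    using l2_bound_l2[OF R_bound[OF l2_bound_norm]] R_add R_mult by (metis mult_1)
  then show ?thesis unfolding l2_spectrum_def using left right by blast
qed

lemma l2_finite_support:
  assumes "finite F" "\<And>n. n \<notin> F \<Longrightarrow> u n = 0"
  shows "u \<in> l2" "(l2_norm u)\<^sup>2 = (\<Sum>n\<in>F. (cmod (u n))\<^sup>2)"
proof -
  have "(\<lambda>n. (cmod (u n))\<^sup>2) summable_on UNIV \<longleftrightarrow> (\<lambda>n. (cmod (u n))\<^sup>2) summable_on F"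
    by (rule summable_on_cong_neutral) (use assms in auto)
  then show "u \<in> l2" using assms by (simp add: l2_def)
  have "(\<Sum>\<^sub>\<infinity>n. (cmod (u n))\<^sup>2) = (\<Sum>\<^sub>\<infinity>n\<in>F. (cmod (u n))\<^sup>2)"
    by (rule infsum_cong_neutral) (use assms in auto)
  then show "(l2_norm u)\<^sup>2 = (\<Sum>n\<in>F. (cmod (u n))\<^sup>2)" using assms by (simp add: l2_norm_def sum_nonneg)
qed

text \<open>A bounded left inverse of norm at most \<open>C\<close> gives \<open>\<parallel>(H - E) u\<parallel> \<ge> \<parallel>u\<parallel> / C\<close>; the
test functions may sit anywhere on the line, hence the shift \<open>m\<close>.\<close>

lemma bounded_below_of_resolvent:
  fixes V :: "int \<Rightarrow> real"
  defines "H \<equiv> \<lambda>u n. - u (n + 1) - u (n - 1) + complex_of_real (V n) * u n"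
  assumes E: "complex_of_real E \<notin> l2_spectrum H"
  shows "\<exists>c>0. \<forall>m. bounded_below_at c E (\<lambda>k. V (m + int k))"
proof -
  have "\<exists>R. l2_bounded_operator R \<and>
     (\<forall>u\<in>l2. R (\<lambda>n. H u n - complex_of_real E * u n) = u \<and> (\<lambda>n. H (R u) n - complex_of_real E * R u n) = u)"
    using E unfolding l2_spectrum_def mem_Collect_eq not_not .
  then obtain R where R: "l2_bounded_operator R"
      "\<And>u. u \<in> l2 \<Longrightarrow> R (\<lambda>n. H u n - complex_of_real E * u n) = u"
    by auto
  obtain C0 where C0: "\<And>u. u \<in> l2 \<Longrightarrow> l2_norm (R u) \<le> C0 * l2_norm u"
    using R(1) unfolding l2_bounded_operator_def by blast
  define C where "C = max C0 1"
  have nn: "0 \<le> l2_norm u" for u by (simp add: l2_norm_def infsum_nonneg)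
  have C: "l2_norm (R u) \<le> C * l2_norm u" if "u \<in> l2" for u
    using C0[OF that] mult_right_mono[of C0 C "l2_norm u"] nn[of u] by (simp add: C_def)
  have C1: "C \<ge> 1" by (simp add: C_def)
  have "bounded_below_at (1 / C) E (\<lambda>k. V (m + int k))" for m
    unfolding bounded_below_at_def
  proof (intro allI impI)
    fix n and u :: "nat \<Rightarrow> real"
    assume u: "u 0 = 0 \<and> (\<forall>k\<ge>n. u k = 0)"
    define U where "U j = complex_of_real (if m \<le> j then u (nat (j - m)) else 0)" for j
    define G where "G = (\<lambda>j. H U j - complex_of_real E * U j)"
    define g where "g k = V (m + int k) * u k - u (Suc k) - u (k - 1) - E * u k" for k
    have Um: "U (m + int k) = of_real (u k)" for k by (simp add: U_def)
    \<comment> \<open>The value at \<open>m\<close> vanishes too, because \<open>u 0 = 0\<close>; this keeps \<open>H U\<close> inside the box.\<close>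
    have Uz: "U j = 0" if "j \<le> m \<or> m + int n \<le> j" for j
    proof (cases "m \<le> j")
      case True
      then have "nat (j - m) = 0 \<or> n \<le> nat (j - m)" using that by linarith
      then show ?thesis using u unfolding U_def by fastforce
    qed (simp add: U_def)
    have U0: "U j = 0" if "j \<notin> {m..m + int n}" for j
      by (rule Uz) (use that in auto)
    have Gm: "G (m + int k) = of_real (g k)" for k
    proof (cases k)
      case 0
      have "U (m - 1) = 0" by (simp add: U_def)
      moreover have "U (m + 1) = of_real (u 1)" "U m = of_real (u 0)" using Um[of 1] Um[of 0] by simp_all
      ultimately show ?thesis using u 0 by (simp add: G_def g_def H_def)
    next
      case (Suc j)
      have "U (m + int k + 1) = of_real (u (Suc k))" using Um[of "Suc k"] by (simp add: algebra_simps)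
      moreover have "U (m + int k - 1) = of_real (u (k - 1))" using Um[of "k - 1"] Suc by (simp add: algebra_simps)
      ultimately show ?thesis using Um[of k] by (simp add: G_def g_def H_def)
    qed
    have G0: "G j = 0" if "j \<notin> {m..m + int n}" for j
    proof -
      have "U (j + 1) = 0" "U (j - 1) = 0" by (rule Uz, use that in auto)+
      then show ?thesis using U0[OF that] by (simp add: G_def H_def)
    qed
    have sum: "(\<Sum>j\<in>{m..m + int n}. (cmod (W j))\<^sup>2) = (\<Sum>k\<le>n. (w k)\<^sup>2)"
      if "\<And>k. W (m + int k) = of_real (w k)" for W :: "int \<Rightarrow> complex" and w :: "nat \<Rightarrow> real"
    proof -
      have "bij_betw (\<lambda>k. m + int k) {..n} {m..m + int n}"
        by (rule bij_betw_byWitness[where f' = "\<lambda>j. nat (j - m)"]) auto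
      then have "(\<Sum>j\<in>{m..m + int n}. (cmod (W j))\<^sup>2) = (\<Sum>k\<le>n. (cmod (W (m + int k)))\<^sup>2)"
        by (rule sum.reindex_bij_betw[symmetric])
      then show ?thesis by (simp add: that)
    qed
    have fin: "finite {m..m + int n}" by simp
    have Ul: "U \<in> l2" "(l2_norm U)\<^sup>2 = (\<Sum>k\<le>n. (u k)\<^sup>2)"
      using l2_finite_support[of _ U, OF fin U0] sum[of U u, OF Um] by auto
    have Gl: "G \<in> l2" "(l2_norm G)\<^sup>2 = (\<Sum>k\<le>n. (g k)\<^sup>2)"
      using l2_finite_support[of _ G, OF fin G0] sum[of G g, OF Gm] by auto
    have "l2_norm U \<le> C * l2_norm G" using C[OF Gl(1)] R(2)[OF Ul(1)] by (simp add: G_def)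
    then have "(l2_norm U)\<^sup>2 \<le> (C * l2_norm G)\<^sup>2" using nn by (intro power_mono) auto
    then have "(1 / C)\<^sup>2 * (l2_norm U)\<^sup>2 \<le> (1 / C)\<^sup>2 * (C * l2_norm G)\<^sup>2"
      by (rule mult_left_mono) simp
    also have "\<dots> = (1 / C * (C * l2_norm G))\<^sup>2" by (rule power_mult_distrib[symmetric])
    also have "1 / C * (C * l2_norm G) = l2_norm G" using C1 by simp
    finally have "(1 / C)\<^sup>2 * (l2_norm U)\<^sup>2 \<le> (l2_norm G)\<^sup>2" .
    then show "(1 / C)\<^sup>2 * (\<Sum>k\<le>n. (u k)\<^sup>2) \<le>
        (\<Sum>k\<le>n. (V (m + int k) * u k - u (Suc k) - u (k - 1) - E * u k)\<^sup>2)"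
      unfolding Ul Gl g_def .
  qed
  then show ?thesis using C1 by (intro exI[of _ "1 / C"]) auto
qed

context ergodic_potential
begin

lemma T_inv: "T (inv T x) = x" "inv T (T x) = x"
  using homeo by (auto simp: homeomorphism_def)

lemma int_iterate_Suc: "int_iterate T (m + 1) x = T (int_iterate T m x)"
proof (cases "m \<ge> 0")
  case True
  then show ?thesis by (simp add: int_iterate_def nat_add_distrib)
next
  case False
  then obtain k where m: "m = - int (Suc k)" by (cases m rule: int_cases) auto
  have neg: "int_iterate T (- int j) x = (inv T ^^ j) x" for j
    by (cases "j = 0") (simp_all add: int_iterate_def)
  have "m + 1 = - int k" using m by simp
  then show ?thesis using neg[of k] neg[of "Suc k"] m T_inv by simp
qed

lemma int_iterate_funpow: "(T ^^ k) (int_iterate T m x) = int_iterate T (m + int k) x"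
proof (induction k)
  case (Suc k)
  have "m + int (Suc k) = (m + int k) + 1" by simp
  then show ?case using Suc int_iterate_Suc by (metis comp_apply funpow.simps(2))
qed simp

text \<open>Minimality speaks about sets that \<open>T\<close> maps onto themselves, which is why the two-sided orbit is used.\<close>

lemma orbit_dense:
  assumes "minimal_homeo T"
  shows "closure (range (\<lambda>m. int_iterate T m x)) = UNIV"
proof -
  let ?O = "range (\<lambda>m. int_iterate T m x)"
  have cinv: "continuous_on UNIV (inv T)" using homeo by (simp add: homeomorphism_def)
  have inv_it: "inv T (int_iterate T m x) = int_iterate T (m - 1) x" for m
    using int_iterate_Suc[of "m - 1" x] T_inv by simp
  have a: "T ` closure ?O \<subseteq> closure ?O"
    by (rule image_closure_subset) (use int_iterate_Suc[symmetric] closure_subset[of ?O]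
      in \<open>auto intro: continuous_on_subset[OF cont_T]\<close>)
  have b: "inv T ` closure ?O \<subseteq> closure ?O"
    by (rule image_closure_subset) (use inv_it closure_subset[of ?O]
      in \<open>auto intro: continuous_on_subset[OF cinv]\<close>)
  have "T ` closure ?O = closure ?O"
  proof
    show "closure ?O \<subseteq> T ` closure ?O"
    proof
      fix y assume "y \<in> closure ?O"
      then have "inv T y \<in> closure ?O" using b by blast
      then show "y \<in> T ` closure ?O" using T_inv(1)[of y] by (metis imageI)
    qed
  qed (rule a)
  then show ?thesis using assms unfolding minimal_homeo_def by (metis closed_closure closure_eq_empty UNIV_I empty_iff image_is_empty)
qed

text \<open>For fixed test data the bound is a closed condition on the base point, and it holds along the dense
orbit of \<open>x0\<close>.\<close>

lemma bounded_below_off_spectrum: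
  assumes "minimal_homeo T" and E: "complex_of_real E \<notin> l2_spectrum (schroedinger T v x0)"
  shows "\<exists>c>0. \<forall>x. bounded_below_at c E (orbit_potential T v x)"
proof -
  have "schroedinger T v x0 = (\<lambda>u n. - u (n + 1) - u (n - 1) + complex_of_real (v (int_iterate T n x0)) * u n)"
    by (simp add: fun_eq_iff schroedinger_def)
  then obtain c where c: "c > 0" "\<And>m. bounded_below_at c E (\<lambda>k. v (int_iterate T (m + int k) x0))"
    using bounded_below_of_resolvent[of E "\<lambda>n. v (int_iterate T n x0)"] E by auto
  have "bounded_below_at c E (orbit_potential T v x)" for x
    unfolding bounded_below_at_def
  proof (intro allI impI)
    fix n :: nat and u :: "nat \<Rightarrow> real" assume u: "u 0 = 0 \<and> (\<forall>k\<ge>n. u k = 0)"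
    let ?P = "{x. c\<^sup>2 * (\<Sum>k\<le>n. (u k)\<^sup>2) \<le>
      (\<Sum>k\<le>n. (orbit_potential T v x k * u k - u (Suc k) - u (k - 1) - E * u k)\<^sup>2)}"
    have "closed ?P"
      by (intro closed_Collect_le continuous_intros cont_orbit_potential)
    moreover have "range (\<lambda>m. int_iterate T m x0) \<subseteq> ?P"
      using c(2) u unfolding bounded_below_at_def by (auto simp: orbit_potential_def int_iterate_funpow)
    ultimately have "closure (range (\<lambda>m. int_iterate T m x0)) \<subseteq> ?P" by (simp add: closure_minimal)
    then show "c\<^sup>2 * (\<Sum>k\<le>n. (u k)\<^sup>2) \<le>
      (\<Sum>k\<le>n. (orbit_potential T v x k * u k - u (Suc k) - u (k - 1) - E * u k)\<^sup>2)"
      unfolding orbit_dense[OF assms(1)] by blast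
  qed
  then show ?thesis using c(1) by blast
qed

text \<open>This makes \<open>L\<close> bounded above on the spectrum, so that the supremum in the
hypothesis of the main result is an actual upper bound.\<close>

lemma spectrum_bounded: "l2_spectrum (schroedinger T v x0) \<subseteq> cball 0 (2 * (2 + vbound))"
proof
  fix E assume "E \<in> l2_spectrum (schroedinger T v x0)"
  then have "\<not> 2 * (2 + vbound) < cmod E"
    using large_not_in_spectrum[of "\<lambda>n. v (int_iterate T n x0)" vbound E] v_bounded
    by (auto simp: schroedinger_def[abs_def])
  then show "E \<in> cball 0 (2 * (2 + vbound))" by simp
qed

section \<open>Finiteness of the contours\<close>

lemma finitely_many_contours:
  assumes "minimal_homeo T" and cL: "continuous_on UNIV L"
    and g: "(SUP E \<in> l2_spectrum (schroedinger T v x0). L E) < g"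
  shows "finite (contour_intervals L g) \<and> {E. L E = g} = (\<Union>J \<in> contour_intervals L g. contour L g J)"
proof -
  define \<Sigma> where "\<Sigma> = l2_spectrum (schroedinger T v x0)"
  define \<sigma> where "\<sigma> = (SUP E \<in> \<Sigma>. L E)"
  have \<sigma>g: "\<sigma> < g" using g by (simp add: \<sigma>_def \<Sigma>_def)
  have "bdd_above (L ` cball 0 (2 * (2 + vbound)))"
    by (intro bounded_imp_bdd_above compact_imp_bounded compact_continuous_image continuous_on_subset[OF cL]) auto
  then have "bdd_above (L ` \<Sigma>)"
    by (rule bdd_above_mono) (use spectrum_bounded[of x0] in \<open>auto simp: \<Sigma>_def\<close>)
  then have on_spec: "L E \<le> \<sigma>" if "E \<in> \<Sigma>" for E unfolding \<sigma>_def using that by (rule cSUP_upper[rotated])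
  define l where "l t = L (complex_of_real t)" for t
  have cl: "continuous_on UNIV l" unfolding l_def
    by (rule continuous_on_compose2[OF cL]) (auto intro: continuous_intros)
  define S where "S = {t. l t < g}"
  define K where "K = {t. l t \<le> \<sigma>}"
  have S: "open S" unfolding S_def by (intro open_Collect_less cl continuous_intros)
  have KS: "K \<subseteq> S" using \<sigma>g by (auto simp: K_def S_def)
  have off: "\<exists>c>0. \<forall>s. 0 < s \<and> s \<le> c \<longrightarrow> l (t + s) + l (t - s) < 2 * l t" if "\<sigma> < l t" for t
  proof -
    have "complex_of_real t \<notin> \<Sigma>" using on_spec that by (force simp: l_def)
    then obtain c where "c > 0" "\<And>x. bounded_below_at c t (orbit_potential T v x)"
      using bounded_below_off_spectrum[OF assms(1)] unfolding \<Sigma>_def by blast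
    then show ?thesis
      using lyapunov_midpoint[OF _ cL, of c t] unfolding l_def by (intro exI[of _ "c / 2"]) auto
  qed
  have bS: "bounded S"
  proof -
    \<comment> \<open>Large enough for the growth bound to reach \<open>g\<close>, and at least one as that bound requires.\<close>
    define k where "k = exp (max 0 g)"
    have k: "1 \<le> k" "g \<le> ln k" by (auto simp: k_def)
    have "\<bar>t\<bar> \<le> vbound + 1 + k" if "t \<in> S" for t
    proof (rule ccontr)
      assume "\<not> ?thesis"
      then have "ln k \<le> l t" unfolding l_def using lyapunov_growth[OF k(1), of "of_real t"] by simp
      then show False using that k by (simp add: S_def)
    qed
    then show ?thesis by (auto simp: bounded_iff)
  qed
  have cK: "compact K"
  proof -
    have "closed K" unfolding K_def by (intro closed_Collect_le cl continuous_intros)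
    then show ?thesis using bounded_subset[OF bS KS] by (simp add: compact_eq_bounded_closed)
  qed
  let ?\<C> = "contour_intervals L g"
  have CI: "?\<C> = components S" by (simp add: contour_intervals_def S_def l_def)
  have hit: "J \<inter> K \<noteq> {}" if J: "J \<in> components S" for J
  proof -
    have JS: "J \<subseteq> S" and Jne: "J \<noteq> {}" and Jc: "connected J"
      using J in_components_subset in_components_nonempty in_components_connected by auto
    have "compact (closure J)" using bounded_subset[OF bS JS] by (simp add: compact_closure)
    moreover have "closure J \<noteq> {}" using Jne by simp
    ultimately obtain t where t: "t \<in> closure J" "\<And>y. y \<in> closure J \<Longrightarrow> l t \<le> l y"
      using continuous_attains_inf[of "closure J" l] continuous_on_subset[OF cl] by blast
    have "l t < g" using Jne JS t(2) closure_subset by (force simp: S_def)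
    then have tS: "t \<in> S" by (simp add: S_def)
    \<comment> \<open>The minimum point lies in \<open>S\<close> and in the closure of the component, hence in the component.\<close>
    have "connected (insert t J)"
      by (rule connected_intermediate_closure[OF Jc]) (use t(1) closure_subset in auto)
    then have "insert t J \<subseteq> J"
      using components_maximal[OF J] tS JS Jne by auto
    then have tJ: "t \<in> J" by auto
    have "open J" using open_components[OF S J] .
    then obtain e where e: "e > 0" "\<And>y. dist y t < e \<Longrightarrow> y \<in> J" using tJ unfolding open_dist by blast
    have "l t \<le> \<sigma>"
    proof (rule ccontr)
      assume "\<not> ?thesis"
      then obtain c where c: "c > 0" "\<And>s. 0 < s \<Longrightarrow> s \<le> c \<Longrightarrow> l (t + s) + l (t - s) < 2 * l t"
        using off[of t] by auto
      define s where "s = min c (e / 2)"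
      have s: "0 < s" "s \<le> c" "s < e" using c e by (auto simp: s_def)
      then have "t + s \<in> J" "t - s \<in> J" using e(2) by (auto simp: dist_real_def)
      then have "l t \<le> l (t + s)" "l t \<le> l (t - s)" using t(2) closure_subset by blast+
      then show False using c(2)[OF s(1,2)] by linarith
    qed
    then show ?thesis using tJ by (auto simp: K_def)
  qed
  have fin: "finite ?\<C>"
  proof -
    have "K \<subseteq> \<Union> (components S)" using KS by simp
    then obtain D where D: "D \<subseteq> components S" "finite D" "K \<subseteq> \<Union> D"
      using compactE[OF cK] open_components[OF S] by (metis (no_types, lifting))
    have "components S \<subseteq> D"
    proof
      fix J assume J: "J \<in> components S"
      then obtain t where t: "t \<in> J" "t \<in> K" using hit by blast
      then obtain J' where J': "J' \<in> D" "t \<in> J'" using D by blast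
      then have "J = J'" using components_nonoverlap[of J S J'] J D t by auto
      then show "J \<in> D" using J' by simp
    qed
    then show ?thesis unfolding CI using D finite_subset by blast
  qed
  have level: "t \<in> closure S" if t: "l t \<le> g" for t
  proof (cases "l t < g")
    case True
    then show ?thesis using closure_subset[of S] by (auto simp: S_def)
  next
    case False
    then have lt: "l t = g" using t by simp
    then obtain c where c: "c > 0" "\<And>s. 0 < s \<Longrightarrow> s \<le> c \<Longrightarrow> l (t + s) + l (t - s) < 2 * g"
      using off[of t] \<sigma>g by auto
    show ?thesis
      unfolding closure_approachable
    proof (intro allI impI)
      fix e :: real assume e: "e > 0"
      define s where "s = min c (e / 2)"
      have s: "0 < s" "s \<le> c" "s < e" using c e by (auto simp: s_def)
      have "t + s \<in> S \<or> t - s \<in> S" using c(2)[OF s(1,2)] by (auto simp: S_def)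
      then show "\<exists>y\<in>S. dist y t < e" using s by (force simp: dist_real_def)
    qed
  qed
  have "E \<in> (\<Union>J\<in>?\<C>. contour L g J)" if E: "L E = g" for E
  proof -
    have "l (Re E) \<le> g" using lyapunov_Re_le[of E] E by (simp add: l_def)
    then have "Re E \<in> closure S" by (rule level)
    also have "closure S \<subseteq> (\<Union>J\<in>components S. closure J)"
    proof (rule closure_minimal)
      show "S \<subseteq> (\<Union>J\<in>components S. closure J)"
      proof
        fix t assume "t \<in> S"
        then obtain J where "J \<in> components S" "t \<in> J" using Union_components[of S] by (metis UnionE)
        then show "t \<in> (\<Union>J\<in>components S. closure J)" using closure_subset[of J] by auto
      qed
      show "closed (\<Union>J\<in>components S. closure J)" using fin[unfolded CI] by (rule closed_UN) simp
    qed
    finally have "Re E \<in> (\<Union>J\<in>components S. closure J)" .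
    then obtain J where J: "J \<in> components S" "Re E \<in> closure J" by (rule UN_E)
    have bJ: "bounded J" by (rule bounded_subset[OF bS in_components_subset[OF J(1)]])
    have "J \<subseteq> {Inf J..Sup J}"
      using bounded_imp_bdd_above[OF bJ] bounded_imp_bdd_below[OF bJ] by (auto intro: cInf_lower cSup_upper)
    then have "closure J \<subseteq> {Inf J..Sup J}" by (rule closure_minimal) auto
    then have "E \<in> contour L g J" using J(2) E by (auto simp: contour_def)
    then show ?thesis unfolding CI using J(1) by blast
  qed
  then have "{E. L E = g} = (\<Union>J\<in>?\<C>. contour L g J)" by (auto simp: contour_def)
  then show ?thesis using fin by blast
qed

end

theorem corollary1p1:
  fixes T :: "'a::metric_space \<Rightarrow> 'a"
    and v :: "'a \<Rightarrow> real"
    and g :: real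
    and \<mu> :: "'a measure"
    and x0 :: 'a
  assumes "compact (UNIV :: 'a set)"
    and "connected (UNIV :: 'a set)"
    and "homeomorphism UNIV UNIV T (inv T)"
    and "strictly_ergodic T"
    and "invariant_prob T \<mu>"
    and "continuous_on UNIV v"
    and "g > 0"
    and "continuous_on UNIV (lyapunov T v \<mu>)"
    and "g > (SUP E \<in> l2_spectrum (schroedinger T v x0). lyapunov T v \<mu> E)"
  shows "finite (contour_intervals (lyapunov T v \<mu>) g) \<and>
    {E. lyapunov T v \<mu> E = g} =
      (\<Union>J \<in> contour_intervals (lyapunov T v \<mu>) g. contour (lyapunov T v \<mu>) g J)"
proof -
  interpret ergodic_potential T v \<mu> by unfold_locales fact+
  show ?thesis
    using assms by (intro finitely_many_contours) (auto simp: strictly_ergodic_def)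
qed

end
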